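(* Let $\sigma:\mathbb{R}^d\to\mathbb{R}^{d\times m}$ and $b:\mathbb{R}^d\to\mathbb{R}^d$ be bounded continuous functions and assume there exist constants $C>0$ and $\mu>0$ such that for every integer $N>e$ and all $x,y\in\mathbb{R}^d$ with $|x|\le N$, $|y|\le N$, $$\|\sigma(x)-\sigma(y)\|\le C\sqrt{\log N}\,|x-y|+C\frac{\log N}{N^{\mu}},\qquad |b(x)-b(y)|\le C\log N\,|x-y|+C\frac{\log N}{N^{\mu}}.$$ Let $x_l\in\mathbb{R}^d$ be a sequence converging to $x\in\mathbb{R}^d$, and let $X_t(x_l)$ and $X_t(x)$ be the unique solutions of $$X_t=z+\int_0^t b(X_s)\,ds+\int_0^t\sigma(X_s)\,dW_s$$ with $z=x_l$ and $z=x$ respectively. Then for any $T\ge0$, $$\lim_{l\to+\infty}\mathbb{E}\sup_{t\le T}|X_t(x_l)-X_t(x)|^2=0.$$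
   Context: $(\Omega,\mathcal{F},(\mathcal{F}_t),\mathbb{P})$ is a complete filtered probability space with right-continuous filtration containing the null sets, and $(W_t)$ is an $\mathbb{R}^m$-valued standard Brownian motion. $|\cdot|$ is the Euclidean norm and $\|\sigma\|^2=\sum_{i,j}\sigma_{ij}^2$. *)

theory Defs
  imports "HOL-Probability.Probability"
begin

text \<open>Complete filtered probability space (time index real; only t \<ge> 0 is relevant):
  increasing family of sub-sigma-algebras, right-continuous, and F 0 contains all
  subsets of null sets (so M is complete and every F t contains the null sets).\<close>
definition filtered_prob_space :: "'a measure \<Rightarrow> (real \<Rightarrow> 'a measure) \<Rightarrow> bool" where
  "filtered_prob_space M F \<longleftrightarrow>
     prob_space M \<and>
     (\<forall>t. subalgebra M (F t)) \<and>
     (\<forall>s t. s \<le> t \<longrightarrow> sets (F s) \<subseteq> sets (F t)) \<and>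
     (\<forall>t. sets (F t) = (\<Inter>s\<in>{t<..}. sets (F s))) \<and>
     (\<forall>A. A \<subseteq> space M \<and> (\<exists>B\<in>null_sets M. A \<subseteq> B) \<longrightarrow> A \<in> sets (F 0))"

definition brownian_motion ::
  "'a measure \<Rightarrow> (real \<Rightarrow> 'a measure) \<Rightarrow> (real \<Rightarrow> 'a \<Rightarrow> real^'m) \<Rightarrow> bool" where
  "brownian_motion M F W \<longleftrightarrow>
     (\<forall>t\<ge>0. W t \<in> borel_measurable (F t)) \<and>
     (\<forall>\<omega>\<in>space M. W 0 \<omega> = 0) \<and>
     (\<forall>\<omega>\<in>space M. continuous_on {0..} (\<lambda>t. W t \<omega>)) \<and>
     (\<forall>s t. 0 \<le> s \<longrightarrow> s < t \<longrightarrow>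
        (\<forall>A\<in>sets (F s). \<forall>B\<in>sets borel.
           measure M (A \<inter> ((\<lambda>\<omega>. W t \<omega> - W s \<omega>) -` B \<inter> space M))
             = measure M A * measure M ((\<lambda>\<omega>. W t \<omega> - W s \<omega>) -` B \<inter> space M)) \<and>
        distributed M lborel (\<lambda>\<omega>. W t \<omega> - W s \<omega>)
          (\<lambda>v. ennreal (\<Prod>i\<in>UNIV. normal_density 0 (sqrt (t - s)) (v $ i))))"

text \<open>I is the Ito integral of the continuous adapted integrand H over [0,t] w.r.t. W,
  characterised as the limit in probability of left-point Riemann sums along
  uniform partitions.\<close>
definition is_ito_integral ::
  "'a measure \<Rightarrow> (real \<Rightarrow> 'a \<Rightarrow> real^'m) \<Rightarrow> (real \<Rightarrow> 'a \<Rightarrow> real^'m^'d) \<Rightarrow> real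
     \<Rightarrow> ('a \<Rightarrow> real^'d) \<Rightarrow> bool" where
  "is_ito_integral M W H t I \<longleftrightarrow>
     I \<in> borel_measurable M \<and>
     (\<forall>\<epsilon>>0. (\<lambda>n::nat. measure M {\<omega>\<in>space M.
        \<epsilon> < norm ((\<Sum>k<n. H (real k * t / real n) \<omega> *v
                   (W (real (Suc k) * t / real n) \<omega> - W (real k * t / real n) \<omega>)) - I \<omega>)})
        \<longlonglongrightarrow> 0)"

definition sde_solution ::
  "'a measure \<Rightarrow> (real \<Rightarrow> 'a measure) \<Rightarrow> (real \<Rightarrow> 'a \<Rightarrow> real^'m)
     \<Rightarrow> (real^'d \<Rightarrow> real^'d) \<Rightarrow> (real^'d \<Rightarrow> real^'m^'d) \<Rightarrow> real^'d
     \<Rightarrow> (real \<Rightarrow> 'a \<Rightarrow> real^'d) \<Rightarrow> bool" where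
  "sde_solution M F W b \<sigma> z X \<longleftrightarrow>
     (\<forall>t\<ge>0. X t \<in> borel_measurable (F t)) \<and>
     (\<forall>\<omega>\<in>space M. continuous_on {0..} (\<lambda>t. X t \<omega>)) \<and>
     (\<forall>t\<ge>0. \<exists>I. is_ito_integral M W (\<lambda>s \<omega>. \<sigma> (X s \<omega>)) t I \<and>
        (AE \<omega> in M. X t \<omega> = z + integral {0..t} (\<lambda>s. b (X s \<omega>)) + I \<omega>))"

end

theory Submission
  imports Defs "HOL-Real_Asymp.Real_Asymp"
begin

text \<open>
  Let \<open>D = X(x\<^sub>l) - X(x)\<close> and \<open>u(t) = E |D\<^sub>t|\<^sup>2\<close>. Splitting according to whether both solutions lie in
  the ball of radius \<open>N\<close> at time \<open>s\<close>, the hypotheses and Chebyshev's inequality give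
  \<open>E \<parallel>\<sigma>(X\<^sub>s(x\<^sub>l)) - \<sigma>(X\<^sub>s(x))\<parallel>\<^sup>2 \<le> c log N (u(s) + e\<^sub>N)\<close> and the same for \<open>b\<close> with \<open>log\<^sup>2 N\<close>, where
  \<open>e\<^sub>N = log N / N\<^sup>p\<close> and \<open>p = min(2, 2\<mu>)\<close>; neither stopping times nor Ito's formula are needed.
  Over a time of length \<open>\<epsilon> / log N\<close> the quantity \<open>u + e\<^sub>N\<close> therefore grows by at most a factor 4, and over
  a time \<open>\<rho>\<close> by at most a constant times \<open>N powr (\<rho> log 4 / \<epsilon>)\<close>. For \<open>\<rho>\<close> small this is beaten by
  \<open>N powr (-p)\<close>, so convergence at the beginning of a time block of length \<open>\<rho>\<close> propagates to the
  whole block. Doob's inequality then gives the supremum.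
\<close>

section \<open>Brownian increments\<close>

text \<open>Stochastic integrals are given only as limits in probability, for one time
  \<open>t\<close> at a time, of left-point sums along uniform partitions of \<open>[0, t]\<close>.
  Integrals at two times are compared along a grid common to both, and this shapes the proof: the
  moment estimates are made at times commensurable with the horizon (\<open>rat_times\<close>),
  where the sums for different times are partial sums over one grid. Bounds are proved for these
  sums and pass to the limit along an almost surely convergent subsequence by Fatou's lemma.

  Since \<open>u\<close> is controlled only at these times, the growth argument bounds it by its
  supremum over a short interval and absorbs half of that supremum, in place of an integral
  inequality. One growth estimate over the whole horizon would give a power of \<open>N\<close>
  increasing with \<open>T\<close>, which the decay of the error need not beat; this is the obstacle
  that the blocks remove.

  Doob's inequality is derived from a pathwise inequality for finite sequences whose correction term
  is a martingale transform of mean zero. Path continuity carries the bound from grid maxima to the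
  supremum.\<close>

lemma Basis_real_vec: "(Basis :: (real^'m) set) = range (\<lambda>i. axis i 1)"
  by (auto simp: Basis_vec_def)

text \<open>The product formula over \<open>Basis\<close> is reindexed by coordinates through
  \<open>e\<close>. It serves to compute marginals of the Gaussian density of an increment.\<close>

lemma nn_integral_lborel_vec_prod:
  fixes g :: "'m::finite \<Rightarrow> real \<Rightarrow> ennreal"
  assumes [measurable]: "\<And>i. g i \<in> borel_measurable borel"
  shows "(\<integral>\<^sup>+v. (\<Prod>i\<in>UNIV. g i (v $ i)) \<partial>(lborel :: (real^'m) measure)) = (\<Prod>i\<in>UNIV. \<integral>\<^sup>+x. g i x \<partial>lborel)"
proof -
  define e where "e = (\<lambda>i::'m. axis i (1::real))"
  have inj: "inj e" by (auto simp: inj_on_def e_def axis_eq_axis)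
  have B: "(Basis :: (real^'m) set) = range e" by (simp add: Basis_real_vec e_def)
  have "(\<integral>\<^sup>+v. (\<Prod>b\<in>Basis. g (inv e b) (v \<bullet> b)) \<partial>(lborel :: (real^'m) measure))
      = (\<Prod>b\<in>(Basis :: (real^'m) set). \<integral>\<^sup>+x. g (inv e b) x \<partial>lborel)"
    by (rule nn_integral_lborel_prod) auto
  then show ?thesis
    unfolding B by (simp add: prod.reindex[OF inj] inj inv_f_f) (simp add: e_def inner_axis)
qed

section \<open>Measurability and norm bounds for matrix-vector products\<close>

lemma borel_measurable_vec_nth [measurable (raw)]:
  fixes f :: "'a \<Rightarrow> 'b::real_normed_vector ^ 'n"
  assumes "f \<in> borel_measurable N"
  shows "(\<lambda>x. f x $ i) \<in> borel_measurable N"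
  by (rule measurable_compose[OF assms])
    (intro borel_measurable_continuous_onI continuous_intros)

lemma borel_measurable_matrix_vector_mult [measurable (raw)]:
  fixes A :: "'a \<Rightarrow> real^'m^'d"
  assumes [measurable]: "A \<in> borel_measurable N" "v \<in> borel_measurable N"
  shows "(\<lambda>x. A x *v v x) \<in> borel_measurable N"
proof (rule borel_measurable_continuous_Pair[OF assms])
  show "continuous_on UNIV (\<lambda>x :: (real^'m^'d) \<times> (real^'m). fst x *v snd x)"
    unfolding matrix_vector_mult_def by (intro continuous_intros)
qed

lemma borel_measurable_vector_matrix_mult [measurable (raw)]:
  fixes A :: "'a \<Rightarrow> real^'m^'d"
  assumes [measurable]: "A \<in> borel_measurable N" "v \<in> borel_measurable N"
  shows "(\<lambda>x. v x v* A x) \<in> borel_measurable N"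
proof (rule borel_measurable_continuous_Pair[OF assms])
  show "continuous_on UNIV (\<lambda>x :: (real^'m^'d) \<times> (real^'d). snd x v* fst x)"
    unfolding vector_matrix_mult_def by (intro continuous_intros)
qed

lemma inner_matrix_vector_mult:
  fixes A :: "real^'m^'d"
  shows "v \<bullet> (A *v w) = (v v* A) \<bullet> w"
  unfolding inner_vec_def matrix_vector_mult_def vector_matrix_mult_def
  by (simp add: sum_distrib_left sum_distrib_right ac_simps) (rule sum.swap)

text \<open>The norm of \<open>real^'m^'d\<close> is the Frobenius norm, so this is Cauchy-Schwarz
  applied to each row.\<close>

lemma norm_matrix_vector_mult_le:
  fixes A :: "real^'m^'d"
  shows "norm (A *v w) \<le> norm A * norm w"
proof -
  have "(norm (A *v w))\<^sup>2 = (\<Sum>i\<in>UNIV. (A $ i \<bullet> w)\<^sup>2)"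
    by (simp add: norm_vec_def L2_set_def sum_nonneg matrix_vector_mult_def inner_vec_def)
  also have "\<dots> \<le> (\<Sum>i\<in>UNIV. (norm (A $ i))\<^sup>2 * (norm w)\<^sup>2)"
    using Cauchy_Schwarz_ineq by (intro sum_mono) (simp add: power2_norm_eq_inner)
  also have "\<dots> = (norm A * norm w)\<^sup>2"
    by (simp add: norm_vec_def[of A] L2_set_def sum_nonneg power_mult_distrib sum_distrib_right)
  finally show ?thesis
    by (rule power2_le_imp_le) simp
qed

text \<open>By duality: \<open>v v* A\<close> is tested against itself and the matrix is moved to
  the other factor, where the previous bound applies.\<close>

lemma norm_vector_matrix_mult_le:
  fixes A :: "real^'m^'d"
  shows "norm (v v* A) \<le> norm v * norm A"
proof (cases "v v* A = 0")
  case False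
  have "norm (v v* A) * norm (v v* A) = v \<bullet> (A *v (v v* A))"
    by (simp only: inner_matrix_vector_mult norm_eq_sqrt_inner real_sqrt_mult_self abs_of_nonneg inner_ge_zero)
  also have "\<dots> \<le> norm v * (norm A * norm (v v* A))"
    by (intro order_trans[OF norm_cauchy_schwarz] mult_left_mono norm_matrix_vector_mult_le) simp
  finally show ?thesis using False by simp
qed simp

section \<open>Moments and independence of Brownian increments\<close>

locale brownian_filtration =
  fixes M :: "'a measure" and F :: "real \<Rightarrow> 'a measure" and W :: "real \<Rightarrow> 'a \<Rightarrow> real^'m"
  assumes fps: "filtered_prob_space M F" and bm: "brownian_motion M F W"

sublocale brownian_filtration \<subseteq> prob_space M
  using fps by (simp add: filtered_prob_space_def)

context brownian_filtration
begin

lemma subalgebra_F: "subalgebra M (F t)"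
  using fps by (simp add: filtered_prob_space_def)

lemma measurable_F_mono:
  assumes "s \<le> t" "f \<in> measurable (F s) N"
  shows "f \<in> measurable (F t) N"
proof -
  have "sets (F s) \<subseteq> sets (F t)"
    using fps assms(1) unfolding filtered_prob_space_def by blast
  moreover have "space (F s) = space (F t)"
    using subalgebra_F unfolding subalgebra_def by metis
  ultimately show ?thesis
    using measurable_mono[OF order_refl refl, of "F s" "F t" N] assms(2) by blast
qed

lemma measurable_F_M: "f \<in> measurable (F s) N \<Longrightarrow> f \<in> measurable M N"
  using subalgebra_F measurable_from_subalg by blast

lemma W_measurable_F: "0 \<le> t \<Longrightarrow> W t \<in> borel_measurable (F t)"
  using bm by (simp add: brownian_motion_def)

lemma W_measurable: "0 \<le> t \<Longrightarrow> W t \<in> borel_measurable M"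
  using W_measurable_F measurable_F_M by blast

lemma distributed_increment:
  assumes "0 \<le> s" "s < t"
  shows "distributed M lborel (\<lambda>\<omega>. W t \<omega> - W s \<omega>)
          (\<lambda>v. ennreal (\<Prod>i\<in>UNIV. normal_density 0 (sqrt (t - s)) (v $ i)))"
  using bm assms by (simp add: brownian_motion_def)

text \<open>The joint density is a product, so every factor except the \<open>i\<close>-th
  integrates to 1 and the marginal is one-dimensional normal.\<close>

lemma distributed_increment_component:
  assumes st: "0 \<le> s" "s < t"
  shows "distributed M lborel (\<lambda>\<omega>. (W t \<omega> - W s \<omega>) $ i) (normal_density 0 (sqrt (t - s)))"
  unfolding distributed_def
proof (intro conjI)
  have [measurable]: "W t \<in> borel_measurable M" "W s \<in> borel_measurable M"
    using W_measurable st by auto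
  show X: "(\<lambda>\<omega>. (W t \<omega> - W s \<omega>) $ i) \<in> measurable M lborel"
    by simp
  show "(\<lambda>x. ennreal (normal_density 0 (sqrt (t - s)) x)) \<in> borel_measurable lborel"
    by simp
  let ?n = "normal_density 0 (sqrt (t - s))"
  have one: "(\<integral>\<^sup>+x. ennreal (?n x) \<partial>lborel) = 1"
    using st by (subst nn_integral_eq_integral) auto
  show "distr M lborel (\<lambda>\<omega>. (W t \<omega> - W s \<omega>) $ i) = density lborel ?n"
  proof (rule measure_eqI)
    fix A assume "A \<in> sets (distr M lborel (\<lambda>\<omega>. (W t \<omega> - W s \<omega>) $ i))"
    then have [measurable]: "A \<in> sets borel" by simp
    have "emeasure (distr M lborel (\<lambda>\<omega>. (W t \<omega> - W s \<omega>) $ i)) A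
        = (\<integral>\<^sup>+y. indicator A y \<partial>distr M lborel (\<lambda>\<omega>. (W t \<omega> - W s \<omega>) $ i))"
      by simp
    also have "\<dots> = (\<integral>\<^sup>+\<omega>. indicator A ((W t \<omega> - W s \<omega>) $ i) \<partial>M)"
      by (rule nn_integral_distr) (use X in auto)
    also have "\<dots> = (\<integral>\<^sup>+v. ennreal (\<Prod>j\<in>UNIV. ?n (v $ j)) * indicator A (v $ i) \<partial>lborel)"
      by (rule distributed_nn_integral[OF distributed_increment[OF st], symmetric]) simp
    \<comment> \<open>The indicator concerns coordinate \<open>i\<close> alone; putting it into that
      factor restores the product form that Fubini needs.\<close>
    also have "\<dots> = (\<integral>\<^sup>+v. (\<Prod>j\<in>UNIV. (\<lambda>x. ennreal (?n x) * (if j = i then indicator A x else 1)) (v $ j))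
                        \<partial>(lborel :: (real^'m) measure))"
      by (intro nn_integral_cong) (simp add: prod.distrib prod_ennreal)
    also have "\<dots> = (\<Prod>j\<in>UNIV. \<integral>\<^sup>+x. ennreal (?n x) * (if j = i then indicator A x else 1) \<partial>lborel)"
      by (rule nn_integral_lborel_vec_prod) simp
    also have "\<dots> = (\<Prod>j\<in>UNIV. if j = i then \<integral>\<^sup>+x. ennreal (?n x) * indicator A x \<partial>lborel else 1)"
      by (intro prod.cong) (auto simp: one)
    also have "\<dots> = emeasure (density lborel ?n) A"
      by (simp add: emeasure_density)
    finally show "emeasure (distr M lborel (\<lambda>\<omega>. (W t \<omega> - W s \<omega>) $ i)) A = emeasure (density lborel ?n) A" .
  qed simp
qed

lemma increment_component_moments:
  assumes st: "0 \<le> s" "s \<le> t"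
  shows "integrable M (\<lambda>\<omega>. (W t \<omega> - W s \<omega>) $ i)" (is ?a)
    and "expectation (\<lambda>\<omega>. (W t \<omega> - W s \<omega>) $ i) = 0" (is ?b)
    and "integrable M (\<lambda>\<omega>. ((W t \<omega> - W s \<omega>) $ i)\<^sup>2)" (is ?c)
    and "expectation (\<lambda>\<omega>. ((W t \<omega> - W s \<omega>) $ i)\<^sup>2) = t - s" (is ?d)
proof -
  have "?a \<and> ?b \<and> ?c \<and> ?d"
  proof (cases "s = t")
    case False
    then have lt: "s < t" and pos: "0 < sqrt (t - s)" using st by auto
    note D = distributed_increment_component[OF st(1) lt, of i]
    have a: ?a
      using distributed_integrable[OF D, of "\<lambda>x. x"] integrable_normal_moment_nz_1[OF pos, of 0]
      by simp
    have b: ?b by (rule normal_distributed_expectation[OF pos D])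
    have c: ?c
      using distributed_integrable[OF D, of "\<lambda>x. x\<^sup>2"] integrable_normal_moment[OF pos, of 0 2]
      by simp
    have d: ?d
      using normal_distributed_variance[OF pos D] lt unfolding b by simp
    show ?thesis using a b c d by blast
  qed simp
  then show ?a ?b ?c ?d by auto
qed

lemma increment_sq:
  assumes st: "0 \<le> s" "s \<le> t"
  shows "integrable M (\<lambda>\<omega>. (norm (W t \<omega> - W s \<omega>))\<^sup>2)"
    and "expectation (\<lambda>\<omega>. (norm (W t \<omega> - W s \<omega>))\<^sup>2) = real CARD('m) * (t - s)"
proof -
  have *: "(norm (v :: real^'m))\<^sup>2 = (\<Sum>i\<in>UNIV. (v $ i)\<^sup>2)" for v
    by (simp add: norm_vec_def L2_set_def sum_nonneg)
  show "integrable M (\<lambda>\<omega>. (norm (W t \<omega> - W s \<omega>))\<^sup>2)"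
    unfolding * using increment_component_moments(3)[OF st] by (intro Bochner_Integration.integrable_sum)
  show "expectation (\<lambda>\<omega>. (norm (W t \<omega> - W s \<omega>))\<^sup>2) = real CARD('m) * (t - s)"
    unfolding * using increment_component_moments(3,4)[OF st]
    by (subst Bochner_Integration.integral_sum) auto
qed

text \<open>The definition of Brownian motion gives the product formula for events only. Preimages
  of Borel sets are closed under intersection, so the formula extends to the generated
  sigma-algebras and hence to functions of the past and of the increment.\<close>

lemma indep_var_increment:
  assumes st: "0 \<le> s" "s < t" and G: "G \<in> borel_measurable (F s)"
    and f[measurable]: "f \<in> borel_measurable borel"
  shows "indep_var borel (G :: 'a \<Rightarrow> real) borel (\<lambda>\<omega>. f (W t \<omega> - W s \<omega>) :: real)"
  unfolding indep_var_eq
proof (intro conjI indep_set_sigma_sets)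
  have [measurable]: "W t \<in> borel_measurable M" "W s \<in> borel_measurable M"
    using W_measurable st by auto
  show G': "G \<in> borel_measurable M" using G measurable_F_M by blast
  show fW: "(\<lambda>\<omega>. f (W t \<omega> - W s \<omega>)) \<in> borel_measurable M" by measurable
  have stable: "Int_stable {h -` A \<inter> space M |A. A \<in> sets borel}" for h :: "'a \<Rightarrow> real"
  proof (rule Int_stableI)
    fix a b assume "a \<in> {h -` A \<inter> space M |A. A \<in> sets borel}" "b \<in> {h -` A \<inter> space M |A. A \<in> sets borel}"
    then obtain A B where "A \<in> sets borel" "B \<in> sets borel" "a = h -` A \<inter> space M" "b = h -` B \<inter> space M"
      by blast
    then show "a \<inter> b \<in> {h -` A \<inter> space M |A. A \<in> sets borel}"
      by (intro CollectI exI[of _ "A \<inter> B"]) auto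
  qed
  show "Int_stable {G -` A \<inter> space M |A. A \<in> sets borel}"
    "Int_stable {(\<lambda>\<omega>. f (W t \<omega> - W s \<omega>)) -` A \<inter> space M |A. A \<in> sets borel}"
    by (rule stable)+
  have sp: "space (F s) = space M" using subalgebra_F by (simp add: subalgebra_def)
  have key: "prob (A \<inter> ((\<lambda>\<omega>. W t \<omega> - W s \<omega>) -` B \<inter> space M))
       = prob A * prob ((\<lambda>\<omega>. W t \<omega> - W s \<omega>) -` B \<inter> space M)" if "A \<in> sets (F s)" "B \<in> sets borel" for A B
    using bm st that by (simp add: brownian_motion_def)
  show "indep_set {G -` A \<inter> space M |A. A \<in> sets borel}
      {(\<lambda>\<omega>. f (W t \<omega> - W s \<omega>)) -` A \<inter> space M |A. A \<in> sets borel}"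
    unfolding indep_sets2_eq
  proof (intro conjI ballI)
    show "{G -` A \<inter> space M |A. A \<in> sets borel} \<subseteq> events"
      using measurable_sets[OF G'] by blast
    show "{(\<lambda>\<omega>. f (W t \<omega> - W s \<omega>)) -` A \<inter> space M |A. A \<in> sets borel} \<subseteq> events"
      using measurable_sets[OF fW] by blast
    fix a b assume "a \<in> {G -` A \<inter> space M |A. A \<in> sets borel}"
      "b \<in> {(\<lambda>\<omega>. f (W t \<omega> - W s \<omega>)) -` A \<inter> space M |A. A \<in> sets borel}"
    then obtain A B where AB[measurable]: "A \<in> sets borel" "B \<in> sets borel"
      and a: "a = G -` A \<inter> space M" and b: "b = (\<lambda>\<omega>. f (W t \<omega> - W s \<omega>)) -` B \<inter> space M"
      by blast
    have "a \<in> sets (F s)" using measurable_sets[OF G AB(1)] sp by (simp add: a)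
    moreover have "f -` B \<in> sets borel" using measurable_sets[OF f AB(2)] by simp
    moreover have "b = (\<lambda>\<omega>. W t \<omega> - W s \<omega>) -` (f -` B) \<inter> space M"
      unfolding b by (simp only: vimage_def mem_Collect_eq)
    ultimately show "prob (a \<inter> b) = prob a * prob b"
      using key[of a "f -` B"] by simp
  qed
qed

lemma expectation_mult_increment:
  assumes st: "0 \<le> s" "s \<le> t" and G: "G \<in> borel_measurable (F s)" "integrable M (G :: 'a \<Rightarrow> real)"
    and f[measurable]: "f \<in> borel_measurable borel"
    and int: "integrable M (\<lambda>\<omega>. f (W t \<omega> - W s \<omega>) :: real)"
  shows "integrable M (\<lambda>\<omega>. G \<omega> * f (W t \<omega> - W s \<omega>))" (is ?a)
    and "expectation (\<lambda>\<omega>. G \<omega> * f (W t \<omega> - W s \<omega>)) = expectation G * expectation (\<lambda>\<omega>. f (W t \<omega> - W s \<omega>))" (is ?b)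
proof -
  have "?a \<and> ?b"
  proof (cases "s = t")
    \<comment> \<open>Here the increment vanishes and the second factor is the constant
      \<open>f 0\<close>; the definition of Brownian motion speaks only of
      \<open>s < t\<close>.\<close>
    case True
    then show ?thesis using G(2) by (simp add: prob_space)
  next
    case False
    then have "s < t" using st by simp
    then show ?thesis
      using indep_var_integrable[OF indep_var_increment[OF st(1) \<open>s < t\<close> G(1) f] G(2) int]
        indep_var_lebesgue_integral[OF indep_var_increment[OF st(1) \<open>s < t\<close> G(1) f] G(2) int] by simp
  qed
  then show ?a ?b by auto
qed

text \<open>The martingale property in integrated form: in each coordinate the expectation
  factorises by independence, and the increment has mean 0.\<close>

lemma expectation_inner_increment:
  fixes G :: "'a \<Rightarrow> real^'m"
  assumes st: "0 \<le> s" "s \<le> t" and G: "G \<in> borel_measurable (F s)" "integrable M G"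
  shows "integrable M (\<lambda>\<omega>. G \<omega> \<bullet> (W t \<omega> - W s \<omega>))"
    and "expectation (\<lambda>\<omega>. G \<omega> \<bullet> (W t \<omega> - W s \<omega>)) = 0"
proof -
  have Gi: "(\<lambda>\<omega>. G \<omega> $ i) \<in> borel_measurable (F s)" "integrable M (\<lambda>\<omega>. G \<omega> $ i)" for i
    using borel_measurable_vec_nth[OF G(1)] integrable_inner_left[OF G(2), of "axis i 1"]
    by (simp_all only: inner_axis inner_real_def mult_1_right)
  note * = expectation_mult_increment[OF st Gi, of "\<lambda>v. v $ _"]
  have i: "integrable M (\<lambda>\<omega>. G \<omega> $ i * (W t \<omega> - W s \<omega>) $ i)" 
    "expectation (\<lambda>\<omega>. G \<omega> $ i * (W t \<omega> - W s \<omega>) $ i) = 0" for i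
    using *[of i i] increment_component_moments(1,2)[OF st, of i] by auto
  show "integrable M (\<lambda>\<omega>. G \<omega> \<bullet> (W t \<omega> - W s \<omega>))"
    unfolding inner_vec_def inner_real_def using i(1) by (intro Bochner_Integration.integrable_sum)
  show "expectation (\<lambda>\<omega>. G \<omega> \<bullet> (W t \<omega> - W s \<omega>)) = 0"
    unfolding inner_vec_def inner_real_def using i by (subst Bochner_Integration.integral_sum) auto
qed

end

section \<open>Doob's inequality for simple integrals\<close>

lemma Max_norm_Suc:
  "(MAX j\<in>{..Suc k}. norm (S j)) = max (norm (S (Suc k))) (MAX j\<in>{..k}. norm (S j))"
  by (simp add: atMost_Suc)

lemma Max_norm_sq:
  "(MAX j\<in>{..(k::nat)}. norm (S j))\<^sup>2 = (MAX j\<in>{..k}. (norm (S j))\<^sup>2)"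
proof (rule Max_eqI[symmetric])
  show "y \<le> (MAX j\<in>{..k}. norm (S j))\<^sup>2" if "y \<in> (\<lambda>j. (norm (S j))\<^sup>2) ` {..k}" for y
    using that by (auto intro!: power_mono Max_ge)
  have "(MAX j\<in>{..k}. norm (S j)) \<in> (\<lambda>j. norm (S j)) ` {..k}"
    by (rule Max_in) auto
  then obtain j where "(MAX j\<in>{..k}. norm (S j)) = norm (S j)" "j \<in> {..k}"
    by (rule imageE)
  then show "(MAX j\<in>{..k}. norm (S j))\<^sup>2 \<in> (\<lambda>j. (norm (S j))\<^sup>2) ` {..k}"
    by (intro image_eqI[of _ _ j]) simp_all
qed simp

text \<open>A deterministic form of Doob's maximal inequality in L2. The subtracted sum is a
  discrete stochastic integral whose weight \<open>R k *\<^sub>R sgn (S k)\<close> depends only on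
  the path up to \<open>k\<close>; for a martingale its expectation vanishes and Doob's constant 4
  remains.\<close>

lemma pathwise_doob:
  fixes S :: "nat \<Rightarrow> 'v::real_inner"
  assumes "S 0 = 0"
  defines "R \<equiv> \<lambda>k. MAX j\<in>{..k}. norm (S j)"
  shows "(R n)\<^sup>2 \<le> 4 * (norm (S n))\<^sup>2 - 4 * (\<Sum>k<n. (R k *\<^sub>R sgn (S k)) \<bullet> (S (Suc k) - S k))"
proof -
  have R_nonneg: "0 \<le> R k" for k
    unfolding R_def by (rule order_trans[OF norm_ge_zero[of "S 0"]]) (intro Max_ge, auto)
  have "(R n)\<^sup>2 / 2 \<le> norm (S n) * R n - (\<Sum>k<n. (R k *\<^sub>R sgn (S k)) \<bullet> (S (Suc k) - S k))"
  proof (induction n)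
    case 0
    then show ?case by (simp add: R_def assms(1))
  next
    case (Suc n)
    have "sgn (S n) \<bullet> S n = norm (S n)"
      by (cases "S n = 0") (auto simp: sgn_div_norm power2_eq_square simp flip: power2_norm_eq_inner)
    moreover have "sgn (S n) \<bullet> S (Suc n) \<le> norm (S (Suc n))"
      using norm_cauchy_schwarz[of "sgn (S n)" "S (Suc n)"] by (simp add: norm_sgn split: if_splits)
    ultimately have "R n * (sgn (S n) \<bullet> (S (Suc n) - S n)) \<le> R n * (norm (S (Suc n)) - norm (S n))"
      by (intro mult_left_mono R_nonneg) (simp add: inner_diff_right)
    moreover have R_Suc: "R (Suc n) = max (norm (S (Suc n))) (R n)"
      unfolding R_def by (rule Max_norm_Suc)
    \<comment> \<open>The running maximum changes only when the new norm attains it; in that case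
      the claim is that the square of \<open>R (Suc n) - R n\<close> is nonnegative.\<close>
    moreover have "(R (Suc n))\<^sup>2 / 2 - (R n)\<^sup>2 / 2 \<le> norm (S (Suc n)) * (R (Suc n) - R n)"
    proof (cases "R n \<le> norm (S (Suc n))")
      case True
      then have "R (Suc n) = norm (S (Suc n))"
        using R_Suc by simp
      then show ?thesis
        using zero_le_power2[of "R (Suc n) - R n"] by (simp add: power2_eq_square algebra_simps)
    next
      case False
      then have "R (Suc n) = R n"
        using R_Suc by simp
      then show ?thesis by simp
    qed
    ultimately show ?case using Suc by (simp add: algebra_simps)
  qed
  \<comment> \<open>Young's inequality, weighted so that a quarter of \<open>(R n)\<^sup>2\<close>
    is absorbed by the half on the left; what is left over produces the factor 4.\<close>
  moreover have "norm (S n) * R n \<le> (R n)\<^sup>2 / 4 + (norm (S n))\<^sup>2"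
    using zero_le_power2[of "R n / 2 - norm (S n)"] by (simp add: power2_eq_square algebra_simps)
  ultimately show ?thesis by linarith
qed

lemma (in finite_measure) integrable_if_square_integrable:
  fixes f :: "'a \<Rightarrow> 'b::{banach, second_countable_topology}"
  assumes "integrable M (\<lambda>x. (norm (f x))\<^sup>2)" "f \<in> borel_measurable M"
  shows "integrable M f"
proof (rule Bochner_Integration.integrable_bound)
  show "integrable M (\<lambda>x. 1 + (norm (f x))\<^sup>2)" using assms by simp
  have "y \<le> 1 + y\<^sup>2" for y :: real
    using zero_le_power2[of "y - 1/2"] by (simp add: power2_eq_square algebra_simps)
  then show "AE x in M. norm (f x) \<le> norm (1 + (norm (f x))\<^sup>2)" by simp
qed (use assms in simp)

text \<open>The discrete setting for martingale estimates: the integrand on each cell is known at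
  its left endpoint, which makes the summands martingale increments, and the bound \<open>K\<close>
  secures all integrability.\<close>

locale simple_ito_sum = brownian_filtration M F W
    for M :: "'a measure" and F and W :: "real \<Rightarrow> 'a \<Rightarrow> real^'m" +
  fixes \<tau> :: "nat \<Rightarrow> real" and H :: "nat \<Rightarrow> 'a \<Rightarrow> real^'m^'d" and K :: real
  assumes \<tau>_nonneg: "\<And>j. 0 \<le> \<tau> j" and \<tau>_mono: "\<And>j. \<tau> j \<le> \<tau> (Suc j)"
    and H_meas: "\<And>j. H j \<in> borel_measurable (F (\<tau> j))"
    and H_bound: "\<And>j \<omega>. norm (H j \<omega>) \<le> K"
begin

definition dW :: "nat \<Rightarrow> 'a \<Rightarrow> real^'m" where
  "dW j \<omega> = W (\<tau> (Suc j)) \<omega> - W (\<tau> j) \<omega>"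

definition S :: "nat \<Rightarrow> 'a \<Rightarrow> real^'d" where
  "S k \<omega> = (\<Sum>j<k. H j \<omega> *v dW j \<omega>)"

lemma S_Suc: "S (Suc k) \<omega> = S k \<omega> + H k \<omega> *v dW k \<omega>"
  by (simp add: S_def)

lemma S_meas: "S k \<in> borel_measurable (F (\<tau> k))"
proof (induction k)
  case 0
  then show ?case by (simp add: S_def)
next
  case (Suc k)
  have [measurable]: "S k \<in> borel_measurable (F (\<tau> (Suc k)))" "H k \<in> borel_measurable (F (\<tau> (Suc k)))"
    "W (\<tau> k) \<in> borel_measurable (F (\<tau> (Suc k)))" "W (\<tau> (Suc k)) \<in> borel_measurable (F (\<tau> (Suc k)))"
    using measurable_F_mono[OF \<tau>_mono] Suc H_meas W_measurable_F[OF \<tau>_nonneg] by blast+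
  show ?case unfolding S_Suc dW_def by measurable
qed

lemma S_meas_M [measurable]: "S k \<in> borel_measurable M"
  and H_meas_M [measurable]: "H k \<in> borel_measurable M"
  and dW_meas_M [measurable]: "dW k \<in> borel_measurable M"
  using measurable_F_M[OF S_meas] measurable_F_M[OF H_meas] W_measurable[OF \<tau>_nonneg]
  by (auto simp: dW_def[abs_def])

lemma H_sq_integrable: "integrable M (\<lambda>\<omega>. (norm (H k \<omega>))\<^sup>2)"
  by (rule integrable_const_bound[where B="K\<^sup>2"]) (auto intro!: power_mono H_bound)

text \<open>The test vector \<open>G\<close> is moved onto the transposed matrix, which leaves a
  vector known at time \<open>\<tau> k\<close> against a Brownian increment. Both the cross terms of
  \<open>S_sq_bound\<close> and the correction terms of \<open>doob_S\<close> are of this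
  form.\<close>

lemma increment_martingale:
  assumes G: "G \<in> borel_measurable (F (\<tau> k))" "integrable M G"
  shows "integrable M (\<lambda>\<omega>. G \<omega> \<bullet> (H k \<omega> *v dW k \<omega>))"
    and "expectation (\<lambda>\<omega>. G \<omega> \<bullet> (H k \<omega> *v dW k \<omega>)) = 0"
proof -
  note [measurable] = G H_meas[of k]
  have m: "(\<lambda>\<omega>. G \<omega> v* H k \<omega>) \<in> borel_measurable (F (\<tau> k))" by measurable
  have i: "integrable M (\<lambda>\<omega>. G \<omega> v* H k \<omega>)"
  proof (rule Bochner_Integration.integrable_bound)
    show "integrable M (\<lambda>\<omega>. norm (G \<omega>) * K)" using G(2) by simp
    show "(\<lambda>\<omega>. G \<omega> v* H k \<omega>) \<in> borel_measurable M" using m measurable_F_M by blast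
    have "norm (G \<omega> v* H k \<omega>) \<le> norm (norm (G \<omega>) * K)" for \<omega>
      using order_trans[OF norm_vector_matrix_mult_le mult_left_mono[OF H_bound norm_ge_zero], of "G \<omega>" k \<omega>]
      by simp
    then show "AE \<omega> in M. norm (G \<omega> v* H k \<omega>) \<le> norm (norm (G \<omega>) * K)" by simp
  qed
  show "integrable M (\<lambda>\<omega>. G \<omega> \<bullet> (H k \<omega> *v dW k \<omega>))"
    "expectation (\<lambda>\<omega>. G \<omega> \<bullet> (H k \<omega> *v dW k \<omega>)) = 0"
    unfolding inner_matrix_vector_mult dW_def
    using expectation_inner_increment[OF \<tau>_nonneg \<tau>_mono m i] by auto
qed

text \<open>Submultiplicativity separates \<open>H k\<close> from \<open>dW k\<close>, and
  independence factorises the expectation. The factor \<open>CARD('m)\<close> is the mean of the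
  squared increment per unit of time; it replaces the exact Ito isometry by an inequality.\<close>

lemma increment_bound:
  shows "integrable M (\<lambda>\<omega>. (norm (H k \<omega> *v dW k \<omega>))\<^sup>2)"
    and "expectation (\<lambda>\<omega>. (norm (H k \<omega> *v dW k \<omega>))\<^sup>2)
      \<le> real CARD('m) * ((\<tau> (Suc k) - \<tau> k) * expectation (\<lambda>\<omega>. (norm (H k \<omega>))\<^sup>2))"
proof -
  note [measurable] = H_meas[of k]
  have m: "(\<lambda>\<omega>. (norm (H k \<omega>))\<^sup>2) \<in> borel_measurable (F (\<tau> k))" by measurable
  note e = expectation_mult_increment[OF \<tau>_nonneg \<tau>_mono m H_sq_integrable, of "\<lambda>v. (norm v)\<^sup>2",
    OF _ increment_sq(1)[OF \<tau>_nonneg \<tau>_mono], unfolded increment_sq(2)[OF \<tau>_nonneg \<tau>_mono],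
    folded dW_def]
  have le: "(norm (H k \<omega> *v dW k \<omega>))\<^sup>2 \<le> (norm (H k \<omega>))\<^sup>2 * (norm (dW k \<omega>))\<^sup>2" for \<omega>
    using power_mono[OF norm_matrix_vector_mult_le norm_ge_zero, of "H k \<omega>" "dW k \<omega>" 2]
    by (simp add: power_mult_distrib)
  show i: "integrable M (\<lambda>\<omega>. (norm (H k \<omega> *v dW k \<omega>))\<^sup>2)"
    by (rule Bochner_Integration.integrable_bound[OF e(1)]) (use le in auto)
  have "expectation (\<lambda>\<omega>. (norm (H k \<omega> *v dW k \<omega>))\<^sup>2)
      \<le> expectation (\<lambda>\<omega>. (norm (H k \<omega>))\<^sup>2 * (norm (dW k \<omega>))\<^sup>2)"
    by (rule integral_mono[OF i e(1)]) (use le in auto)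
  also have "\<dots> = real CARD('m) * ((\<tau> (Suc k) - \<tau> k) * expectation (\<lambda>\<omega>. (norm (H k \<omega>))\<^sup>2))"
    using e(2) by simp
  finally show "expectation (\<lambda>\<omega>. (norm (H k \<omega> *v dW k \<omega>))\<^sup>2)
      \<le> real CARD('m) * ((\<tau> (Suc k) - \<tau> k) * expectation (\<lambda>\<omega>. (norm (H k \<omega>))\<^sup>2))" .
qed

text \<open>The increments are orthogonal, so the cross term disappears when the square is expanded.
  Integrability belongs to the induction because the martingale property at step \<open>k\<close>
  presupposes that \<open>S k\<close> is integrable.\<close>

lemma S_sq_bound:
  "integrable M (\<lambda>\<omega>. (norm (S k \<omega>))\<^sup>2) \<and> expectation (\<lambda>\<omega>. (norm (S k \<omega>))\<^sup>2)
     \<le> real CARD('m) * (\<Sum>j<k. (\<tau> (Suc j) - \<tau> j) * expectation (\<lambda>\<omega>. (norm (H j \<omega>))\<^sup>2))"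
proof (induction k)
  case 0
  then show ?case by (simp add: S_def)
next
  case (Suc k)
  have i: "integrable M (S k)"
    using integrable_if_square_integrable[of "S k"] Suc by simp
  note a = increment_martingale[OF S_meas i] and b = increment_bound[of k]
  have eq: "(norm (S (Suc k) \<omega>))\<^sup>2 = (norm (S k \<omega>))\<^sup>2 + 2 * (S k \<omega> \<bullet> (H k \<omega> *v dW k \<omega>))
      + (norm (H k \<omega> *v dW k \<omega>))\<^sup>2" for \<omega>
    by (simp add: S_Suc power2_norm_eq_inner inner_add_left inner_add_right inner_commute)
  show ?case
    unfolding eq using Suc a b by (simp add: algebra_simps)
qed

lemma Max_S_integrable: "integrable M (\<lambda>\<omega>. (MAX j\<in>{..k}. norm (S j \<omega>))\<^sup>2)"
proof (rule Bochner_Integration.integrable_bound)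
  show "integrable M (\<lambda>\<omega>. \<Sum>j\<le>k. (norm (S j \<omega>))\<^sup>2)"
    using S_sq_bound by (intro Bochner_Integration.integrable_sum) auto
  show "(\<lambda>\<omega>. (MAX j\<in>{..k}. norm (S j \<omega>))\<^sup>2) \<in> borel_measurable M" by measurable
  have "(MAX j\<in>{..k}. norm (S j \<omega>))\<^sup>2 \<le> (\<Sum>j\<le>k. (norm (S j \<omega>))\<^sup>2)" for \<omega>
    unfolding Max_norm_sq by (auto intro!: member_le_sum)
  then show "AE \<omega> in M. norm ((MAX j\<in>{..k}. norm (S j \<omega>))\<^sup>2) \<le> norm (\<Sum>j\<le>k. (norm (S j \<omega>))\<^sup>2)"
    by (simp add: sum_nonneg)
qed

text \<open>Expectations are taken in \<open>pathwise_doob\<close>. The weights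
  \<open>R k *\<^sub>R sgn (S k)\<close> are measurable at time \<open>\<tau> k\<close> and
  integrable, so the correction sum has mean 0.\<close>

lemma doob_S:
  "expectation (\<lambda>\<omega>. (MAX j\<in>{..n}. norm (S j \<omega>))\<^sup>2)
     \<le> 4 * (real CARD('m) * (\<Sum>j<n. (\<tau> (Suc j) - \<tau> j) * expectation (\<lambda>\<omega>. (norm (H j \<omega>))\<^sup>2)))"
proof -
  define R where "R = (\<lambda>k \<omega>. MAX j\<in>{..k}. norm (S j \<omega>))"
  have R_nonneg: "0 \<le> R k \<omega>" for k \<omega>
    unfolding R_def by (rule order_trans[OF norm_ge_zero[of "S 0 \<omega>"]]) (intro Max_ge, auto)
  have R_int: "integrable M (\<lambda>\<omega>. (R k \<omega>)\<^sup>2)" for k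
    using Max_S_integrable by (simp add: R_def)
  have G: "(\<lambda>\<omega>. R k \<omega> *\<^sub>R sgn (S k \<omega>)) \<in> borel_measurable (F (\<tau> k))" for k
  proof -
    have [measurable]: "S j \<in> borel_measurable (F (\<tau> k))" if "j \<le> k" for j
      using lift_Suc_mono_le[of \<tau>, OF \<tau>_mono that] S_meas measurable_F_mono by blast
    have [measurable]: "R k \<in> borel_measurable (F (\<tau> k))"
      unfolding R_def by (rule borel_measurable_Max) auto
    have [measurable]: "S k \<in> borel_measurable (F (\<tau> k))" by (rule S_meas)
    show ?thesis by measurable
  qed
  have G_int: "integrable M (\<lambda>\<omega>. R k \<omega> *\<^sub>R sgn (S k \<omega>))" for k
  proof (rule integrable_if_square_integrable)
    show m: "(\<lambda>\<omega>. R k \<omega> *\<^sub>R sgn (S k \<omega>)) \<in> borel_measurable M"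
      using G measurable_F_M by blast
    show "integrable M (\<lambda>\<omega>. (norm (R k \<omega> *\<^sub>R sgn (S k \<omega>)))\<^sup>2)"
    proof (rule Bochner_Integration.integrable_bound[OF R_int[of k]])
      show "(\<lambda>\<omega>. (norm (R k \<omega> *\<^sub>R sgn (S k \<omega>)))\<^sup>2) \<in> borel_measurable M"
        using m by measurable
    qed (simp add: norm_sgn)
  qed
  note d = increment_martingale[OF G G_int]
  have "expectation (\<lambda>\<omega>. (R n \<omega>)\<^sup>2) \<le> expectation (\<lambda>\<omega>. 4 * (norm (S n \<omega>))\<^sup>2
      - 4 * (\<Sum>k<n. (R k \<omega> *\<^sub>R sgn (S k \<omega>)) \<bullet> (H k \<omega> *v dW k \<omega>)))"
  proof (rule integral_mono)
    show "integrable M (\<lambda>\<omega>. (R n \<omega>)\<^sup>2)" by (rule R_int)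
    show "integrable M (\<lambda>\<omega>. 4 * (norm (S n \<omega>))\<^sup>2
      - 4 * (\<Sum>k<n. (R k \<omega> *\<^sub>R sgn (S k \<omega>)) \<bullet> (H k \<omega> *v dW k \<omega>)))"
      using S_sq_bound[of n] d(1) by (intro Bochner_Integration.integrable_diff integrable_mult_right Bochner_Integration.integrable_sum) auto
    show "(R n \<omega>)\<^sup>2 \<le> 4 * (norm (S n \<omega>))\<^sup>2
      - 4 * (\<Sum>k<n. (R k \<omega> *\<^sub>R sgn (S k \<omega>)) \<bullet> (H k \<omega> *v dW k \<omega>))" for \<omega>
      using pathwise_doob[of "\<lambda>k. S k \<omega>" n] by (simp add: R_def S_Suc) (simp add: S_def)
  qed
  also have "\<dots> = 4 * expectation (\<lambda>\<omega>. (norm (S n \<omega>))\<^sup>2)"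
    using S_sq_bound[of n] d by (simp add: Bochner_Integration.integral_diff Bochner_Integration.integral_sum)
  finally show ?thesis using S_sq_bound[of n] unfolding R_def by linarith
qed

end

section \<open>Ito processes with bounded coefficients\<close>

text \<open>Uniform continuity bounds the error on a cell by \<open>\<epsilon> * \<delta>\<close>,
  and the cells are added by induction. The sample points are those of
  \<open>is_ito_integral\<close>, so drift and noise live on the same grid.\<close>

lemma riemann_sum_tendsto_integral:
  fixes f :: "real \<Rightarrow> 'b::banach"
  assumes t: "0 \<le> t" and f: "continuous_on {0..t} f"
  shows "(\<lambda>n. \<Sum>k<n. (t / real n) *\<^sub>R f (real k * t / real n)) \<longlonglongrightarrow> integral {0..t} f"
proof (rule LIMSEQ_I)
  fix e :: real assume "0 < e"
  \<comment> \<open>The summand 1 covers \<open>t = 0\<close> and leaves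
    \<open>\<epsilon> * t\<close> strictly below \<open>e\<close>.\<close>
  define \<epsilon> where "\<epsilon> = e / (t + 1)"
  have \<epsilon>: "0 < \<epsilon>" "\<epsilon> * t < e"
    using t \<open>0 < e\<close> by (auto simp: \<epsilon>_def field_simps)
  have "uniformly_continuous_on {0..t} f"
    using f by (intro compact_uniformly_continuous) auto
  then obtain d where d: "0 < d" "\<And>x y. x \<in> {0..t} \<Longrightarrow> y \<in> {0..t} \<Longrightarrow> dist y x < d \<Longrightarrow> dist (f y) (f x) < \<epsilon>"
    using \<epsilon>(1) unfolding uniformly_continuous_on_def by metis
  obtain n0 where n0: "t / d < real n0" using reals_Archimedean2 by blast
  show "\<exists>no. \<forall>n\<ge>no. norm ((\<Sum>k<n. (t / real n) *\<^sub>R f (real k * t / real n)) - integral {0..t} f) < e"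
  proof (intro exI[of _ "Suc n0"] allI impI)
    fix n assume n: "Suc n0 \<le> n"
    define \<delta> where "\<delta> = t / real n"
    have n_pos: "0 < real n" using n by simp
    have \<delta>: "0 \<le> \<delta>" "real n * \<delta> = t" using t n_pos by (auto simp: \<delta>_def)
    have "t < d * real n" using n n0 d(1) by (simp add: field_simps) (smt (verit) mult_left_mono of_nat_mono of_nat_Suc)
    then have \<delta>d: "\<delta> < d" using n_pos by (simp add: \<delta>_def field_simps)
    have "norm ((\<Sum>k<j. \<delta> *\<^sub>R f (real k * \<delta>)) - integral {0..real j * \<delta>} f) \<le> real j * (\<epsilon> * \<delta>)" if "j \<le> n" for j
      using that
    proof (induction j)
      case 0
      then show ?case by simp
    next
      case (Suc j)
      have jt: "real j * \<delta> \<le> real (Suc j) * \<delta>" "real (Suc j) * \<delta> \<le> t" "0 \<le> real j * \<delta>"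
        using \<delta>(1) mult_right_mono[of "real (Suc j)" "real n" \<delta>] Suc.prems unfolding \<delta>(2)
        by (auto intro!: mult_right_mono)
      have cont: "continuous_on {real j * \<delta>..real (Suc j) * \<delta>} f"
        using f by (rule continuous_on_subset) (use jt in auto)
      have split: "integral {0..real (Suc j) * \<delta>} f
          = integral {0..real j * \<delta>} f + integral {real j * \<delta>..real (Suc j) * \<delta>} f"
        using jt by (intro Henstock_Kurzweil_Integration.integral_combine[symmetric]
            integrable_continuous_real continuous_on_subset[OF f]) auto
      have len: "real (Suc j) * \<delta> - real j * \<delta> = \<delta>" by (simp add: algebra_simps)
      have int: "f integrable_on {real j * \<delta>..real (Suc j) * \<delta>}"
        using cont by (rule integrable_continuous_real)
      have "integral {real j * \<delta>..real (Suc j) * \<delta>} (\<lambda>x. f x - f (real j * \<delta>))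
          = integral {real j * \<delta>..real (Suc j) * \<delta>} f - \<delta> *\<^sub>R f (real j * \<delta>)"
        using int jt len by (subst Henstock_Kurzweil_Integration.integral_diff) auto
      moreover have "norm (integral {real j * \<delta>..real (Suc j) * \<delta>} (\<lambda>x. f x - f (real j * \<delta>)))
          \<le> \<epsilon> * (real (Suc j) * \<delta> - real j * \<delta>)"
      proof (rule integral_bound[OF jt(1)])
        show "continuous_on {real j * \<delta>..real (Suc j) * \<delta>} (\<lambda>x. f x - f (real j * \<delta>))"
          using cont by (intro continuous_intros)
        fix x assume x: "x \<in> {real j * \<delta>..real (Suc j) * \<delta>}"
        then have "dist x (real j * \<delta>) < d"
          using \<delta>d len by (auto simp: dist_real_def)
        then have "dist (f x) (f (real j * \<delta>)) < \<epsilon>"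
          using x jt by (intro d(2)) auto
        then show "norm (f x - f (real j * \<delta>)) \<le> \<epsilon>" by (simp add: dist_norm)
      qed
      ultimately have "norm (\<delta> *\<^sub>R f (real j * \<delta>) - integral {real j * \<delta>..real (Suc j) * \<delta>} f) \<le> \<epsilon> * \<delta>"
        unfolding len by (metis norm_minus_commute)
      moreover have "norm ((\<Sum>k<j. \<delta> *\<^sub>R f (real k * \<delta>)) - integral {0..real j * \<delta>} f) \<le> real j * (\<epsilon> * \<delta>)"
        using Suc by simp
      moreover have "(\<Sum>k<Suc j. \<delta> *\<^sub>R f (real k * \<delta>)) - integral {0..real (Suc j) * \<delta>} f
        = ((\<Sum>k<j. \<delta> *\<^sub>R f (real k * \<delta>)) - integral {0..real j * \<delta>} f)
          + (\<delta> *\<^sub>R f (real j * \<delta>) - integral {real j * \<delta>..real (Suc j) * \<delta>} f)"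
        unfolding split by simp
      ultimately show ?case
        using norm_triangle_ineq[of "(\<Sum>k<j. \<delta> *\<^sub>R f (real k * \<delta>)) - integral {0..real j * \<delta>} f"
            "\<delta> *\<^sub>R f (real j * \<delta>) - integral {real j * \<delta>..real (Suc j) * \<delta>} f"]
        by (simp add: algebra_simps)
    qed
    from this[of n] have "norm ((\<Sum>k<n. \<delta> *\<^sub>R f (real k * \<delta>)) - integral {0..t} f) \<le> \<epsilon> * t"
      unfolding \<delta>(2) by (simp flip: \<delta>(2) add: ac_simps)
    then show "norm ((\<Sum>k<n. (t / real n) *\<^sub>R f (real k * t / real n)) - integral {0..t} f) < e"
      using \<epsilon>(2) by (simp add: \<delta>_def)
  qed
qed

text \<open>A single subsequence must serve all \<open>i\<close> at once, because maxima over
  \<open>i\<close> are taken later. The distances, truncated at 1, are summed over the finite set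
  \<open>A\<close>; convergence in probability makes this sum tend to 0 in L1, and one almost surely
  convergent subsequence is extracted from it.\<close>

lemma (in prob_space) in_probability_AE_subseq:
  fixes X :: "nat \<Rightarrow> 'i \<Rightarrow> 'a \<Rightarrow> 'b::{second_countable_topology, real_normed_vector}"
  assumes A: "finite A"
    and X [measurable]: "\<And>n i. i \<in> A \<Longrightarrow> X n i \<in> borel_measurable M"
    and I [measurable]: "\<And>i. i \<in> A \<Longrightarrow> I i \<in> borel_measurable M"
    and lim: "\<And>i \<epsilon>. i \<in> A \<Longrightarrow> 0 < \<epsilon> \<Longrightarrow>
        (\<lambda>n. prob {\<omega> \<in> space M. \<epsilon> < norm (X n i \<omega> - I i \<omega>)}) \<longlonglongrightarrow> 0"
  shows "\<exists>r::nat \<Rightarrow> nat. strict_mono r \<and> (AE \<omega> in M. \<forall>i\<in>A. (\<lambda>n. X (r n) i \<omega>) \<longlonglongrightarrow> I i \<omega>)"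
proof -
  define v where "v = (\<lambda>n i \<omega>. min 1 (norm (X n i \<omega> - I i \<omega>)))"
  define u where "u = (\<lambda>n \<omega>. \<Sum>i\<in>A. v n i \<omega>)"
  have v_meas [measurable]: "v n i \<in> borel_measurable M" if "i \<in> A" for n i
    unfolding v_def using that by measurable
  have v_nonneg: "0 \<le> v n i \<omega>" and v_le: "v n i \<omega> \<le> 1" for n i \<omega> by (auto simp: v_def)
  have v_int: "integrable M (v n i)" if "i \<in> A" for n i
    using that v_nonneg v_le by (intro integrable_const_bound[where B=1]) auto
  have v_lim: "(\<lambda>n. expectation (v n i)) \<longlonglongrightarrow> 0" if i: "i \<in> A" for i
  proof (rule LIMSEQ_I)
    fix e :: real assume e: "0 < e"
    have "\<forall>\<^sub>F n in sequentially. prob {\<omega> \<in> space M. e / 2 < norm (X n i \<omega> - I i \<omega>)} < e / 2"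
      using order_tendstoD(2)[OF lim[OF i, of "e / 2"], of "e / 2"] e by simp
    then obtain no where no: "\<And>n. no \<le> n \<Longrightarrow> prob {\<omega> \<in> space M. e / 2 < norm (X n i \<omega> - I i \<omega>)} < e / 2"
      by (auto simp: eventually_sequentially)
    have "expectation (v n i) < e" if n: "no \<le> n" for n
    proof -
      let ?B = "{\<omega> \<in> space M. e / 2 < norm (X n i \<omega> - I i \<omega>)}"
      have B [measurable]: "?B \<in> events" using i by measurable
      \<comment> \<open>Off \<open>?B\<close> the truncated distance is at most
        \<open>e / 2\<close>; on \<open>?B\<close> it is at most 1.\<close>
      have "expectation (v n i) \<le> expectation (\<lambda>\<omega>. e / 2 + indicator ?B \<omega>)"
      proof (rule integral_mono[OF v_int[OF i]])
        show "integrable M (\<lambda>\<omega>. e / 2 + indicator ?B \<omega>)"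
          by (intro Bochner_Integration.integrable_add integrable_const integrable_real_indicator B)
            (simp add: emeasure_eq_measure)
      qed (use e in \<open>auto simp: v_def indicator_def\<close>)
      also have "\<dots> = e / 2 + prob ?B"
        by (subst Bochner_Integration.integral_add)
          (use B in \<open>auto simp: emeasure_eq_measure prob_space simp del: indicator_simps intro!: integrable_real_indicator\<close>)
      finally show ?thesis using no[OF n] by simp
    qed
    moreover have "0 \<le> expectation (v n i)" for n by (simp add: v_nonneg)
    ultimately show "\<exists>no. \<forall>n\<ge>no. norm (expectation (v n i) - 0) < e" by auto
  qed
  have u_int: "integrable M (u n)" for n
    unfolding u_def using v_int by (intro Bochner_Integration.integrable_sum) auto
  have "(\<lambda>n. \<Sum>i\<in>A. expectation (v n i)) \<longlonglongrightarrow> (\<Sum>i\<in>A. 0)"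
    by (intro tendsto_sum v_lim)
  moreover have "expectation (\<lambda>\<omega>. norm (u n \<omega>)) = (\<Sum>i\<in>A. expectation (v n i))" for n
    unfolding u_def using v_int by (simp add: sum_nonneg v_nonneg Bochner_Integration.integral_sum)
  ultimately have "(\<lambda>n. expectation (\<lambda>\<omega>. norm (u n \<omega>))) \<longlonglongrightarrow> 0" by simp
  from tendsto_L1_AE_subseq[OF u_int this] obtain r where r: "strict_mono r"
    and AE: "AE \<omega> in M. (\<lambda>n. u (r n) \<omega>) \<longlonglongrightarrow> 0" by blast
  have "(\<lambda>n. X (r n) i \<omega>) \<longlonglongrightarrow> I i \<omega>" if i: "i \<in> A" and u: "(\<lambda>n. u (r n) \<omega>) \<longlonglongrightarrow> 0" for i \<omega>
  proof (rule LIMSEQ_I)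
    fix e :: real assume e: "0 < e"
    have "v n i \<omega> \<le> u n \<omega>" for n
      unfolding u_def using A i v_nonneg by (intro member_le_sum) auto
    moreover obtain no where "\<And>n. no \<le> n \<Longrightarrow> u (r n) \<omega> < min 1 e"
      using order_tendstoD(2)[OF u, of "min 1 e"] e by (auto simp: eventually_sequentially)
    ultimately have "v (r n) i \<omega> < min 1 e" if "no \<le> n" for n
      using that order_le_less_trans by blast
    then have "norm (X (r n) i \<omega> - I i \<omega>) < e" if "no \<le> n" for n
      using that by (fastforce simp: v_def min_def split: if_splits)
    then show "\<exists>no. \<forall>n\<ge>no. norm (X (r n) i \<omega> - I i \<omega>) < e" by blast
  qed
  then show ?thesis using r AE by (intro exI[of _ r]) auto
qed

lemma norm_add_sq_le:
  fixes x y :: "'b::real_inner"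
  shows "(norm (x + y))\<^sup>2 \<le> 2 * (norm x)\<^sup>2 + 2 * (norm y)\<^sup>2"
  using zero_le_power2[of "norm (x - y)"]
  by (simp add: power2_norm_eq_inner inner_add_left inner_add_right inner_diff_left inner_diff_right inner_commute)

text \<open>An abstraction that covers a single solution and the difference of two solutions alike.
  The null set in \<open>Y_eq\<close> depends on \<open>t\<close>, so the identity can be used
  simultaneously at countably many times only.\<close>

locale ito_process = brownian_filtration M F W
  for M :: "'a measure" and F and W :: "real \<Rightarrow> 'a \<Rightarrow> real^'m" +
  fixes \<beta> :: "real \<Rightarrow> 'a \<Rightarrow> real^'d" and H :: "real \<Rightarrow> 'a \<Rightarrow> real^'m^'d"
    and y\<^sub>0 :: "real^'d" and Y :: "real \<Rightarrow> 'a \<Rightarrow> real^'d" and K :: real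
  assumes \<beta>_meas: "\<And>t. 0 \<le> t \<Longrightarrow> \<beta> t \<in> borel_measurable M"
    and \<beta>_cont: "\<And>\<omega>. \<omega> \<in> space M \<Longrightarrow> continuous_on {0..} (\<lambda>t. \<beta> t \<omega>)"
    and \<beta>_bound: "\<And>t \<omega>. norm (\<beta> t \<omega>) \<le> K"
    and H_meas: "\<And>t. 0 \<le> t \<Longrightarrow> H t \<in> borel_measurable (F t)"
    and H_bound: "\<And>t \<omega>. norm (H t \<omega>) \<le> K"
    and Y_meas: "\<And>t. 0 \<le> t \<Longrightarrow> Y t \<in> borel_measurable M"
    and Y_eq: "\<And>t. 0 \<le> t \<Longrightarrow> \<exists>I. is_ito_integral M W H t I \<and>
        (AE \<omega> in M. Y t \<omega> = y\<^sub>0 + integral {0..t} (\<lambda>s. \<beta> s \<omega>) + I \<omega>)"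
begin

text \<open>At \<open>t = 0\<close> every Riemann sum is 0, so the probabilities do not depend on
  \<open>n\<close>; their limit 0 forces the Ito integral to vanish almost everywhere.\<close>

lemma Y_0: "AE \<omega> in M. Y 0 \<omega> = y\<^sub>0"
proof -
  obtain I where I: "is_ito_integral M W H 0 I" and AE: "AE \<omega> in M. Y 0 \<omega> = y\<^sub>0 + I \<omega>"
    using Y_eq[of 0] by auto
  have [measurable]: "I \<in> borel_measurable M" using I by (simp add: is_ito_integral_def)
  have "prob {\<omega> \<in> space M. \<epsilon> < norm (I \<omega>)} = 0" if "0 < \<epsilon>" for \<epsilon>
    using I that by (auto simp: is_ito_integral_def LIMSEQ_const_iff)
  then have "AE \<omega> in M. \<not> 1 / real (Suc n) < norm (I \<omega>)" for n
    by (subst AE_iff_measurable[OF _ refl]) (auto simp: emeasure_eq_measure)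
  then have "AE \<omega> in M. \<forall>n. \<not> 1 / real (Suc n) < norm (I \<omega>)"
    by (simp add: AE_all_countable)
  then have "AE \<omega> in M. I \<omega> = 0"
  proof eventually_elim
    case (elim \<omega>)
    show ?case
    proof (rule ccontr)
      assume "I \<omega> \<noteq> 0"
      then obtain n where "1 / real (Suc n) < norm (I \<omega>)"
        using nat_approx_posE[of "norm (I \<omega>)"] by auto
      then show False using elim by blast
    qed
  qed
  then show ?thesis using AE by eventually_elim simp
qed

text \<open>Blocks are addressed by indices \<open>a\<close> and \<open>b\<close> in a grid of mesh
  \<open>\<delta>\<close>, not by times, so that sums over adjacent blocks of one grid add up
  exactly.\<close>

definition drift_sum :: "real \<Rightarrow> nat \<Rightarrow> nat \<Rightarrow> 'a \<Rightarrow> real^'d" where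
  "drift_sum \<delta> a b \<omega> = (\<Sum>k\<in>{a..<b}. \<delta> *\<^sub>R \<beta> (real k * \<delta>) \<omega>)"

definition ito_sum :: "real \<Rightarrow> nat \<Rightarrow> nat \<Rightarrow> 'a \<Rightarrow> real^'d" where
  "ito_sum \<delta> a b \<omega> = (\<Sum>k\<in>{a..<b}. H (real k * \<delta>) \<omega> *v (W (real (Suc k) * \<delta>) \<omega> - W (real k * \<delta>) \<omega>))"


lemma measurable_at_time [measurable]:
  assumes "0 \<le> t"
  shows "\<beta> t \<in> borel_measurable M" "H t \<in> borel_measurable M" "W t \<in> borel_measurable M" "Y t \<in> borel_measurable M"
  using \<beta>_meas H_meas Y_meas W_measurable measurable_F_M assms by blast+

lemma drift_sum_meas:
  assumes "0 \<le> \<delta>" shows "drift_sum \<delta> a b \<in> borel_measurable M"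
  unfolding drift_sum_def[abs_def] using assms
  by (intro borel_measurable_sum borel_measurable_scaleR borel_measurable_const measurable_at_time) simp

lemma ito_sum_meas:
  assumes "0 \<le> \<delta>" shows "ito_sum \<delta> a b \<in> borel_measurable M"
  unfolding ito_sum_def[abs_def] using assms
  by (intro borel_measurable_sum borel_measurable_matrix_vector_mult borel_measurable_diff measurable_at_time) auto

lemma \<beta>_sq_integrable: "0 \<le> t \<Longrightarrow> integrable M (\<lambda>\<omega>. (norm (\<beta> t \<omega>))\<^sup>2)"
  by (rule integrable_const_bound[where B="K\<^sup>2"]) (auto intro!: power_mono \<beta>_bound)

text \<open>Cauchy-Schwarz in time. The right-hand side involves the last index \<open>c\<close> and
  not \<open>b\<close>, which makes the bound survive a maximum over \<open>b\<close>.\<close>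

lemma norm_drift_sum_sq_le:
  assumes "a \<le> b" "b \<le> c" "0 \<le> \<delta>"
  shows "(norm (drift_sum \<delta> a b \<omega>))\<^sup>2 \<le> real (c - a) * \<delta> * (\<Sum>k\<in>{a..<c}. \<delta> * (norm (\<beta> (real k * \<delta>) \<omega>))\<^sup>2)"
proof -
  have "norm (drift_sum \<delta> a b \<omega>) \<le> (\<Sum>k\<in>{a..<b}. \<delta> * norm (\<beta> (real k * \<delta>) \<omega>))"
    unfolding drift_sum_def by (rule order_trans[OF norm_sum]) (use assms in simp)
  also have "\<dots> \<le> (\<Sum>k\<in>{a..<c}. \<delta> * norm (\<beta> (real k * \<delta>) \<omega>))"
    using assms by (intro sum_mono2) auto
  finally have "(norm (drift_sum \<delta> a b \<omega>))\<^sup>2 \<le> (\<Sum>k\<in>{a..<c}. \<delta> * norm (\<beta> (real k * \<delta>) \<omega>))\<^sup>2"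
    by (intro power_mono) auto
  also have "\<dots> \<le> (\<Sum>k\<in>{a..<c}. (\<delta> * norm (\<beta> (real k * \<delta>) \<omega>))\<^sup>2) * real (card {a..<c})"
    by (rule sum_squared_le_sum_of_squares)
  also have "\<dots> = real (c - a) * \<delta> * (\<Sum>k\<in>{a..<c}. \<delta> * (norm (\<beta> (real k * \<delta>) \<omega>))\<^sup>2)"
    by (simp add: sum_distrib_left sum_distrib_right power_mult_distrib power2_eq_square ac_simps)
  finally show ?thesis .
qed

text \<open>Cauchy-Schwarz controls the drift and Doob the noise. Separating the two costs a factor
  2, and 8 is this 2 times Doob's 4. The set \<open>A\<close> selects the grid indices that remain
  meaningful when the mesh is refined.\<close>

lemma max_riemann_sum_bound:
  assumes \<delta>: "0 \<le> \<delta>" and ac: "a \<le> c" and A: "finite A" "A \<noteq> {}" "A \<subseteq> {a..c}"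
    and B: "\<And>k. a \<le> k \<Longrightarrow> k < c \<Longrightarrow> expectation (\<lambda>\<omega>. (norm (\<beta> (real k * \<delta>) \<omega>))\<^sup>2) \<le> B"
    and Q: "\<And>k. a \<le> k \<Longrightarrow> k < c \<Longrightarrow> expectation (\<lambda>\<omega>. (norm (H (real k * \<delta>) \<omega>))\<^sup>2) \<le> Q"
  shows "(\<integral>\<^sup>+\<omega>. ennreal (MAX b\<in>A. (norm (drift_sum \<delta> a b \<omega> + ito_sum \<delta> a b \<omega>))\<^sup>2) \<partial>M)
    \<le> ennreal (2 * (real (c - a) * \<delta>)\<^sup>2 * B + 8 * real CARD('m) * (real (c - a) * \<delta>) * Q)"
proof -
  \<comment> \<open>The indices are shifted by \<open>a\<close>, so that the martingale starts from
    0 at the beginning of the block.\<close>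
  interpret S: simple_ito_sum M F W "\<lambda>j. real (a + j) * \<delta>" "\<lambda>j. H (real (a + j) * \<delta>)" K
    using \<delta> H_meas H_bound by unfold_locales (auto intro!: mult_right_mono)
  have ito_S: "ito_sum \<delta> a b \<omega> = S.S (b - a) \<omega>" if "a \<le> b" for b \<omega>
    unfolding ito_sum_def S.S_def S.dW_def sum.atLeastLessThan_shift_0[of _ a b] atLeast0LessThan
    using that by (simp add: comp_def)
  define V where "V = (\<lambda>\<omega>. 2 * (real (c - a) * \<delta> * (\<Sum>k\<in>{a..<c}. \<delta> * (norm (\<beta> (real k * \<delta>) \<omega>))\<^sup>2))
      + 2 * (MAX j\<in>{..c - a}. norm (S.S j \<omega>))\<^sup>2)"
  have V_int: "integrable M V"
    unfolding V_def using \<beta>_sq_integrable \<delta> S.Max_S_integrable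
    by (intro Bochner_Integration.integrable_add integrable_mult_right Bochner_Integration.integrable_sum) auto
  have V_nonneg: "0 \<le> V \<omega>" for \<omega>
    unfolding V_def using \<delta> by (auto intro!: add_nonneg_nonneg mult_nonneg_nonneg sum_nonneg)
  have le: "(norm (drift_sum \<delta> a b \<omega> + ito_sum \<delta> a b \<omega>))\<^sup>2 \<le> V \<omega>" if "b \<in> A" for b \<omega>
  proof -
    have b: "a \<le> b" "b \<le> c" using that A by auto
    have "(norm (ito_sum \<delta> a b \<omega>))\<^sup>2 \<le> (MAX j\<in>{..c - a}. norm (S.S j \<omega>))\<^sup>2"
      unfolding ito_S[OF b(1)] using b by (auto intro!: power_mono Max_ge)
    moreover have "(norm (drift_sum \<delta> a b \<omega> + ito_sum \<delta> a b \<omega>))\<^sup>2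
        \<le> 2 * (norm (drift_sum \<delta> a b \<omega>))\<^sup>2 + 2 * (norm (ito_sum \<delta> a b \<omega>))\<^sup>2"
      by (rule norm_add_sq_le)
    ultimately show ?thesis
      using norm_drift_sum_sq_le[OF b \<delta>, of \<omega>] unfolding V_def by linarith
  qed
  have "(\<integral>\<^sup>+\<omega>. ennreal (MAX b\<in>A. (norm (drift_sum \<delta> a b \<omega> + ito_sum \<delta> a b \<omega>))\<^sup>2) \<partial>M) \<le> (\<integral>\<^sup>+\<omega>. ennreal (V \<omega>) \<partial>M)"
    using A le by (intro nn_integral_mono ennreal_leI) (auto intro!: Max.boundedI)
  also have "\<dots> = ennreal (expectation V)"
    using V_int V_nonneg by (intro nn_integral_eq_integral) auto
  also have "expectation V \<le> 2 * (real (c - a) * \<delta>)\<^sup>2 * B + 8 * real CARD('m) * (real (c - a) * \<delta>) * Q"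
  proof -
    have "expectation V = 2 * (real (c - a) * \<delta> * (\<Sum>k\<in>{a..<c}. \<delta> * expectation (\<lambda>\<omega>. (norm (\<beta> (real k * \<delta>) \<omega>))\<^sup>2)))
      + 2 * expectation (\<lambda>\<omega>. (MAX j\<in>{..c - a}. norm (S.S j \<omega>))\<^sup>2)"
      unfolding V_def using \<beta>_sq_integrable \<delta> S.Max_S_integrable
      by (simp add: Bochner_Integration.integral_sum)
    moreover have "(\<Sum>k\<in>{a..<c}. \<delta> * expectation (\<lambda>\<omega>. (norm (\<beta> (real k * \<delta>) \<omega>))\<^sup>2)) \<le> (\<Sum>k\<in>{a..<c}. \<delta> * B)"
      using B \<delta> by (intro sum_mono mult_left_mono) auto
    then have "2 * (real (c - a) * \<delta> * (\<Sum>k\<in>{a..<c}. \<delta> * expectation (\<lambda>\<omega>. (norm (\<beta> (real k * \<delta>) \<omega>))\<^sup>2)))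
        \<le> 2 * (real (c - a) * \<delta> * (\<Sum>k\<in>{a..<c}. \<delta> * B))"
      using \<delta> by (intro mult_left_mono) auto
    moreover have "expectation (\<lambda>\<omega>. (MAX j\<in>{..c - a}. norm (S.S j \<omega>))\<^sup>2)
      \<le> 4 * (real CARD('m) * (\<Sum>j<c - a. \<delta> * Q))"
    proof (rule order_trans[OF S.doob_S])
      have "(\<Sum>j<c - a. (real (a + Suc j) * \<delta> - real (a + j) * \<delta>) * expectation (\<lambda>\<omega>. (norm (H (real (a + j) * \<delta>) \<omega>))\<^sup>2))
          \<le> (\<Sum>j<c - a. \<delta> * Q)"
      proof (rule sum_mono)
        fix j assume "j \<in> {..<c - a}"
        then have "expectation (\<lambda>\<omega>. (norm (H (real (a + j) * \<delta>) \<omega>))\<^sup>2) \<le> Q"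
          by (intro Q) auto
        moreover have "real (a + Suc j) * \<delta> - real (a + j) * \<delta> = \<delta>" by (simp add: algebra_simps)
        ultimately show "(real (a + Suc j) * \<delta> - real (a + j) * \<delta>)
            * expectation (\<lambda>\<omega>. (norm (H (real (a + j) * \<delta>) \<omega>))\<^sup>2) \<le> \<delta> * Q"
          using \<delta> by (simp only: mult_left_mono)
      qed
      then show "4 * (real CARD('m) * (\<Sum>j<c - a. (real (a + Suc j) * \<delta> - real (a + j) * \<delta>)
          * expectation (\<lambda>\<omega>. (norm (H (real (a + j) * \<delta>) \<omega>))\<^sup>2))) \<le> 4 * (real CARD('m) * (\<Sum>j<c - a. \<delta> * Q))"
        by (intro mult_left_mono) auto
    qed
    moreover have "2 * (real (c - a) * \<delta> * (\<Sum>k\<in>{a..<c}. \<delta> * B)) = 2 * (real (c - a) * \<delta>)\<^sup>2 * B"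
      "4 * (real CARD('m) * (\<Sum>j<c - a. \<delta> * Q)) = 4 * real CARD('m) * (real (c - a) * \<delta>) * Q"
      by (simp_all add: power2_eq_square)
    ultimately show ?thesis by linarith
  qed
  finally show ?thesis by (simp add: ennreal_leI)
qed

text \<open>Dividing \<open>[0, i h]\<close> into \<open>i * n\<close> cells gives mesh
  \<open>h / n\<close> whatever \<open>i\<close> is; passing to the subsequence \<open>i * n\<close>
  thus puts all these intervals on one grid.\<close>

lemma drift_sum_tendsto:
  assumes h: "0 < h" and \<omega>: "\<omega> \<in> space M"
  shows "(\<lambda>n. drift_sum (h / real n) 0 (i * n) \<omega>) \<longlonglongrightarrow> integral {0..real i * h} (\<lambda>s. \<beta> s \<omega>)"
proof (cases "i = 0")
  case True
  then show ?thesis by (simp add: drift_sum_def)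
next
  case False
  have "(\<lambda>n. \<Sum>k<n. (real i * h / real n) *\<^sub>R \<beta> (real k * (real i * h) / real n) \<omega>)
      \<longlonglongrightarrow> integral {0..real i * h} (\<lambda>s. \<beta> s \<omega>)"
    using h by (intro riemann_sum_tendsto_integral continuous_on_subset[OF \<beta>_cont[OF \<omega>]]) auto
  from LIMSEQ_subseq_LIMSEQ[OF this, of "\<lambda>n. i * n"] show ?thesis
    using False by (simp add: strict_mono_def drift_sum_def atLeast0LessThan comp_def)
qed

lemma ito_sum_in_probability:
  assumes h: "0 < h" and I: "is_ito_integral M W H (real i * h) I" and \<epsilon>: "0 < \<epsilon>"
  shows "(\<lambda>n. prob {\<omega> \<in> space M. \<epsilon> < norm (ito_sum (h / real n) 0 (i * n) \<omega> - I \<omega>)}) \<longlonglongrightarrow> 0"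
proof -
  let ?J = "\<lambda>n \<omega>. (\<Sum>k<n. H (real k * (real i * h) / real n) \<omega> *v
      (W (real (Suc k) * (real i * h) / real n) \<omega> - W (real k * (real i * h) / real n) \<omega>))"
  have lim: "(\<lambda>n. prob {\<omega> \<in> space M. \<epsilon> < norm (?J n \<omega> - I \<omega>)}) \<longlonglongrightarrow> 0"
    using I \<epsilon> unfolding is_ito_integral_def by blast
  show ?thesis
  proof (cases "i = 0")
    \<comment> \<open>For \<open>i = 0\<close> the indices \<open>i * n\<close> do not form a
      subsequence, but both kinds of sums are 0.\<close>
    case True
    then show ?thesis using lim by (simp add: ito_sum_def)
  next
    case False
    then have "?J (i * n) \<omega> = ito_sum (h / real n) 0 (i * n) \<omega>" for n \<omega>
      by (simp add: ito_sum_def atLeast0LessThan)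
    with LIMSEQ_subseq_LIMSEQ[OF lim, of "\<lambda>n. i * n"] show ?thesis
      using False by (simp add: strict_mono_def comp_def)
  qed
qed

text \<open>Restricting to multiples of one step \<open>h\<close> makes all the uniform partitions with \<open>i * n\<close>
  pieces of \<open>[0, i h]\<close> restrictions of a single grid, so that differences of Ito integrals are
  limits of sums over the later part of that grid.\<close>
lemma ito_max_increment:
  assumes h: "0 < h" and i: "i0 \<le> i1"
    and B: "\<And>n k. 0 < n \<Longrightarrow> i0 * n \<le> k \<Longrightarrow> k < i1 * n \<Longrightarrow>
        expectation (\<lambda>\<omega>. (norm (\<beta> (real k * (h / real n)) \<omega>))\<^sup>2) \<le> B"
    and Q: "\<And>n k. 0 < n \<Longrightarrow> i0 * n \<le> k \<Longrightarrow> k < i1 * n \<Longrightarrow>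
        expectation (\<lambda>\<omega>. (norm (H (real k * (h / real n)) \<omega>))\<^sup>2) \<le> Q"
  shows "(\<integral>\<^sup>+\<omega>. ennreal (MAX i\<in>{i0..i1}. (norm (Y (real i * h) \<omega> - Y (real i0 * h) \<omega>))\<^sup>2) \<partial>M)
    \<le> ennreal (2 * (real (i1 - i0) * h)\<^sup>2 * B + 8 * real CARD('m) * (real (i1 - i0) * h) * Q)"
    (is "_ \<le> ennreal ?R")
proof -
  have nn: "0 \<le> real i * h" for i using h by simp
  have "\<forall>i. \<exists>I. is_ito_integral M W H (real i * h) I \<and>
      (AE \<omega> in M. Y (real i * h) \<omega> = y\<^sub>0 + integral {0..real i * h} (\<lambda>s. \<beta> s \<omega>) + I \<omega>)"
    by (intro allI Y_eq nn)
  from choice[OF this] obtain I where "\<forall>i. is_ito_integral M W H (real i * h) (I i) \<and>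
      (AE \<omega> in M. Y (real i * h) \<omega> = y\<^sub>0 + integral {0..real i * h} (\<lambda>s. \<beta> s \<omega>) + I i \<omega>)"
    by (elim exE)
  then have I: "is_ito_integral M W H (real i * h) (I i)"
    and Y: "AE \<omega> in M. Y (real i * h) \<omega> = y\<^sub>0 + integral {0..real i * h} (\<lambda>s. \<beta> s \<omega>) + I i \<omega>" for i
    by simp_all
  have I_meas: "I i \<in> borel_measurable M" for i
    using I by (simp add: is_ito_integral_def)
  \<comment> \<open>One subsequence for the whole range of \<open>i\<close>; without it the maximum
    could not be followed to the limit.\<close>
  obtain r where r: "strict_mono r"
    and ito_lim: "AE \<omega> in M. \<forall>i\<in>{i0..i1}. (\<lambda>n. ito_sum (h / real (r n)) 0 (i * r n) \<omega>) \<longlonglongrightarrow> I i \<omega>"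
    using in_probability_AE_subseq[of "{i0..i1}" "\<lambda>n i. ito_sum (h / real n) 0 (i * n)" I]
      ito_sum_meas h I_meas ito_sum_in_probability[OF h I] by auto
  define Z where "Z = (\<lambda>n i \<omega>. drift_sum (h / real n) (i0 * n) (i * n) \<omega> + ito_sum (h / real n) (i0 * n) (i * n) \<omega>)"
  define V where "V = (\<lambda>n \<omega>. MAX i\<in>{i0..i1}. (norm (Z n i \<omega>))\<^sup>2)"
  have Z_meas: "Z n i \<in> borel_measurable M" for n i
    unfolding Z_def using h by (intro borel_measurable_add drift_sum_meas ito_sum_meas) auto
  have V_meas: "V n \<in> borel_measurable M" for n
    unfolding V_def using Z_meas by measurable
  have V_le: "(\<integral>\<^sup>+\<omega>. ennreal (V n \<omega>) \<partial>M) \<le> ennreal ?R" if n: "0 < n" for n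
  proof -
    have "(\<integral>\<^sup>+\<omega>. ennreal (MAX b\<in>(\<lambda>i. i * n) ` {i0..i1}. (norm (drift_sum (h / real n) (i0 * n) b \<omega>
          + ito_sum (h / real n) (i0 * n) b \<omega>))\<^sup>2) \<partial>M)
        \<le> ennreal (2 * (real (i1 * n - i0 * n) * (h / real n))\<^sup>2 * B
          + 8 * real CARD('m) * (real (i1 * n - i0 * n) * (h / real n)) * Q)"
      using h i n B Q by (intro max_riemann_sum_bound) auto
    moreover have "real (i1 * n - i0 * n) * (h / real n) = real (i1 - i0) * h"
      using n by (simp flip: diff_mult_distrib)
    ultimately show ?thesis
      by (simp only: V_def Z_def image_image)
  qed
  have AE_lim: "AE \<omega> in M. \<forall>i\<in>{i0..i1}.
      (\<lambda>n. Z (r n) i \<omega>) \<longlonglongrightarrow> Y (real i * h) \<omega> - Y (real i0 * h) \<omega>"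
  proof -
    have "AE \<omega> in M. \<forall>i. Y (real i * h) \<omega> = y\<^sub>0 + integral {0..real i * h} (\<lambda>s. \<beta> s \<omega>) + I i \<omega>"
      using Y by (simp add: AE_all_countable)
    with ito_lim AE_space show ?thesis
    proof eventually_elim
      case (elim \<omega>)
      show ?case
      proof
        fix i assume i: "i \<in> {i0..i1}"
        have D: "(\<lambda>n. drift_sum (h / real (r n)) 0 (j * r n) \<omega>) \<longlonglongrightarrow> integral {0..real j * h} (\<lambda>s. \<beta> s \<omega>)" for j
          using LIMSEQ_subseq_LIMSEQ[OF drift_sum_tendsto[OF h, of \<omega> j] r] elim by (simp add: comp_def)
        \<comment> \<open>Sums over a later block are differences of sums starting at time 0, the
          only ones whose limits are known.\<close>
        have split: "Z n i \<omega> = (drift_sum (h / real n) 0 (i * n) \<omega> - drift_sum (h / real n) 0 (i0 * n) \<omega>)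
           + (ito_sum (h / real n) 0 (i * n) \<omega> - ito_sum (h / real n) 0 (i0 * n) \<omega>)" for n
          unfolding Z_def drift_sum_def ito_sum_def
          using i by (simp only: sum_diff_nat_ivl[of 0 "i0 * n" "i * n"] le0 mult_le_mono1 atLeastAtMost_iff)
        have "(\<lambda>n. Z (r n) i \<omega>) \<longlonglongrightarrow>
            (integral {0..real i * h} (\<lambda>s. \<beta> s \<omega>) - integral {0..real i0 * h} (\<lambda>s. \<beta> s \<omega>)) + (I i \<omega> - I i0 \<omega>)"
          unfolding split using elim i \<open>i0 \<le> i1\<close> by (intro tendsto_intros D) auto
        moreover have "Y (real i * h) \<omega> - Y (real i0 * h) \<omega> =
            (integral {0..real i * h} (\<lambda>s. \<beta> s \<omega>) - integral {0..real i0 * h} (\<lambda>s. \<beta> s \<omega>)) + (I i \<omega> - I i0 \<omega>)"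
          using elim by (simp add: algebra_simps)
        ultimately show "(\<lambda>n. Z (r n) i \<omega>) \<longlonglongrightarrow> Y (real i * h) \<omega> - Y (real i0 * h) \<omega>" by simp
      qed
    qed
  qed
  \<comment> \<open>Fatou's lemma: the sums converge almost everywhere, while their expected maxima
    are merely bounded, which is enough for an upper estimate. The maximum of the limits is attained
    at some \<open>j\<close>, where it lies below the limit inferior of the maxima.\<close>
  have "(\<integral>\<^sup>+\<omega>. ennreal (MAX i\<in>{i0..i1}. (norm (Y (real i * h) \<omega> - Y (real i0 * h) \<omega>))\<^sup>2) \<partial>M)
      \<le> (\<integral>\<^sup>+\<omega>. liminf (\<lambda>n. ennreal (V (r n) \<omega>)) \<partial>M)"
  proof (rule nn_integral_mono_AE)
    show "AE \<omega> in M. ennreal (MAX i\<in>{i0..i1}. (norm (Y (real i * h) \<omega> - Y (real i0 * h) \<omega>))\<^sup>2)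
        \<le> liminf (\<lambda>n. ennreal (V (r n) \<omega>))"
      using AE_lim
    proof eventually_elim
      case (elim \<omega>)
      have "(MAX i\<in>{i0..i1}. (norm (Y (real i * h) \<omega> - Y (real i0 * h) \<omega>))\<^sup>2)
          \<in> (\<lambda>i. (norm (Y (real i * h) \<omega> - Y (real i0 * h) \<omega>))\<^sup>2) ` {i0..i1}"
        using i by (intro Max_in) auto
      then obtain j where j: "j \<in> {i0..i1}" and eq: "(MAX i\<in>{i0..i1}. (norm (Y (real i * h) \<omega> - Y (real i0 * h) \<omega>))\<^sup>2)
          = (norm (Y (real j * h) \<omega> - Y (real i0 * h) \<omega>))\<^sup>2"
        by (rule imageE)
      have "(\<lambda>n. ennreal ((norm (Z (r n) j \<omega>))\<^sup>2)) \<longlonglongrightarrow> ennreal ((norm (Y (real j * h) \<omega> - Y (real i0 * h) \<omega>))\<^sup>2)"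
        using elim j by (intro tendsto_ennrealI tendsto_intros) auto
      then have "ennreal ((norm (Y (real j * h) \<omega> - Y (real i0 * h) \<omega>))\<^sup>2) = liminf (\<lambda>n. ennreal ((norm (Z (r n) j \<omega>))\<^sup>2))"
        by (rule lim_imp_Liminf[OF trivial_limit_sequentially, symmetric])
      also have "\<dots> \<le> liminf (\<lambda>n. ennreal (V (r n) \<omega>))"
        unfolding V_def using j by (intro Liminf_mono always_eventually allI ennreal_leI Max_ge) auto
      finally show ?case unfolding eq .
    qed
  qed
  also have "\<dots> \<le> liminf (\<lambda>n. \<integral>\<^sup>+\<omega>. ennreal (V (r n) \<omega>) \<partial>M)"
    by (intro nn_integral_liminf measurable_compose[OF V_meas] measurable_ennreal)
  also have "\<dots> \<le> ennreal ?R"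
  proof (rule Liminf_le[OF trivial_limit_sequentially])
    show "\<forall>\<^sub>F n in sequentially. (\<integral>\<^sup>+\<omega>. ennreal (V (r n) \<omega>) \<partial>M) \<le> ennreal ?R"
      unfolding eventually_sequentially
      using strict_mono_imp_increasing[OF r] by (intro exI[of _ 1] allI impI V_le) (metis less_le_trans zero_less_one le_trans)
  qed
  finally show ?thesis .
qed

end

section \<open>A Gronwall lemma with logarithmic constants\<close>

text \<open>The times commensurable with \<open>T\<close>. Any two are multiples of a common step,
  as the comparison of Ito integrals requires, and the set contains all uniform subdivisions of
  \<open>[0, T]\<close> and of intervals between its points.\<close>

definition rat_times :: "real \<Rightarrow> real set" where
  "rat_times T = {t. 0 \<le> t \<and> t \<le> T \<and> t / T \<in> \<rat>}"

lemma rat_times_fraction: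
  assumes "0 < T" "i \<le> n" "0 < n"
  shows "T * real i / real n \<in> rat_times T"
proof -
  have "T * real i \<le> T * real n" using assms by (intro mult_left_mono) auto
  moreover have "T * real i / real n / T = real i / real n" using assms by simp
  ultimately show ?thesis using assms by (simp add: rat_times_def field_simps)
qed

lemma rat_times_between:
  assumes T: "0 < T" and st: "s \<in> rat_times T" "t \<in> rat_times T" and le: "s \<le> t" "i \<le> n" and n: "0 < n"
  shows "s + (t - s) * (real i / real n) \<in> rat_times T"
proof -
  have "(t - s) * (real i / real n) \<le> (t - s) * 1"
    using le n by (intro mult_left_mono) auto
  moreover have "0 \<le> (t - s) * (real i / real n)" using le by simp
  moreover have "(s + (t - s) * (real i / real n)) / T = s / T + (t / T - s / T) * (real i / real n)"
    by (simp add: add_divide_distrib flip: diff_divide_distrib)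
  moreover have "s / T + (t / T - s / T) * (real i / real n) \<in> \<rat>"
    using st by (auto simp: rat_times_def intro!: Rats_add Rats_mult Rats_diff Rats_divide)
  ultimately show ?thesis using st by (auto simp: rat_times_def)
qed

text \<open>The hypothesis \<open>step\<close> compares \<open>u l t\<close> with a bound
  \<open>V\<close> on all of \<open>[s, t]\<close>, so only values at rational times enter and no
  regularity in time is assumed. The uniform bound \<open>U\<close> makes suprema finite, so that a
  fraction of them can be absorbed. The order of choices is essential: \<open>N\<close> is fixed by
  the desired accuracy, and only then is \<open>l\<close> taken large.\<close>

lemma logarithmic_gronwall:
  fixes u :: "nat \<Rightarrow> real \<Rightarrow> real"
  assumes T: "0 < T" and p: "0 < p" and c: "0 < c"
    and nonneg: "\<And>l t. t \<in> rat_times T \<Longrightarrow> 0 \<le> u l t"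
    and bdd: "\<And>l t. t \<in> rat_times T \<Longrightarrow> u l t \<le> U"
    and step: "\<And>l N s t V. real N > exp 1 \<Longrightarrow> s \<in> rat_times T \<Longrightarrow> t \<in> rat_times T \<Longrightarrow> s \<le> t \<Longrightarrow>
        (\<And>r. r \<in> rat_times T \<Longrightarrow> s \<le> r \<Longrightarrow> r \<le> t \<Longrightarrow> u l r \<le> V) \<Longrightarrow>
        u l t \<le> 2 * u l s + c * (((t - s) * ln (real N))\<^sup>2 + (t - s) * ln (real N))
                              * (V + ln (real N) * real N powr - p)"
    and init: "(\<lambda>l. u l 0) \<longlonglongrightarrow> 0"
    and \<eta>: "0 < \<eta>"
  shows "\<forall>\<^sub>F l in sequentially. \<forall>t\<in>rat_times T. u l t \<le> \<eta>"
proof -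
  \<comment> \<open>For \<open>0 \<le> x \<le> \<epsilon>\<close> the bound 1 gives
    \<open>x\<^sup>2 \<le> x\<close>, and the bound \<open>1 / (4 * c)\<close> then gives
    \<open>c * (x\<^sup>2 + x) \<le> 1 / 2\<close>: half of the supremum can be absorbed.\<close>
  define \<epsilon> where "\<epsilon> = min 1 (1 / (4 * c))"
  have \<epsilon>: "0 < \<epsilon>" "\<epsilon> \<le> 1" using c by (auto simp: \<epsilon>_def)
  have "c * \<epsilon> \<le> c * (1 / (4 * c))"
    using c by (intro mult_left_mono) (auto simp: \<epsilon>_def)
  then have c\<epsilon>: "c * (2 * \<epsilon>) \<le> 1 / 2" using c by simp
  define e where "e = (\<lambda>N::nat. ln (real N) * real N powr - p)"
  have ln1: "1 < ln (real N)" if "real N > exp 1" for N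
    using that ln_less_cancel_iff[of "exp 1" "real N"] less_trans[OF exp_gt_zero that] by simp
  have e_nonneg: "0 \<le> e N" if "real N > exp 1" for N
    using ln1[OF that] by (simp add: e_def)
  have small: "u l t + e N \<le> 4 * (u l s + e N)"
    if N: "real N > exp 1" and st: "s \<in> rat_times T" "t \<in> rat_times T" "s \<le> t"
      and len: "(t - s) * ln (real N) \<le> \<epsilon>" for l N s t
  proof -
    let ?A = "u l ` {r \<in> rat_times T. s \<le> r \<and> r \<le> t}"
    have bA: "bdd_above ?A" using bdd by (auto intro!: bdd_aboveI)
    define m where "m = Sup ?A"
    have V: "u l r \<le> m" if "r \<in> rat_times T" "s \<le> r" "r \<le> t" for r
      using that unfolding m_def by (intro cSup_upper bA) auto
    have V0: "0 \<le> m" using V[of s] nonneg[of s l] st by simp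
    have "u l r \<le> 2 * u l s + 1 / 2 * (m + e N)" if r: "r \<in> rat_times T" "s \<le> r" "r \<le> t" for r
    proof -
      have "u l r \<le> 2 * u l s + c * (((r - s) * ln (real N))\<^sup>2 + (r - s) * ln (real N)) * (m + e N)"
        unfolding e_def using r V by (intro step[OF N st(1)]) auto
      moreover have "c * (((r - s) * ln (real N))\<^sup>2 + (r - s) * ln (real N)) \<le> 1 / 2"
      proof -
        define x where "x = (r - s) * ln (real N)"
        have x: "0 \<le> x" using r ln1[OF N] by (simp add: x_def)
        have "x \<le> (t - s) * ln (real N)"
          unfolding x_def using r ln1[OF N] by (intro mult_right_mono) auto
        with len have "x \<le> \<epsilon>" by simp
        moreover then have "x\<^sup>2 \<le> x"
          using x \<epsilon>(2) by (simp add: power2_eq_square mult_left_le)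
        ultimately have "c * (x\<^sup>2 + x) \<le> c * (2 * \<epsilon>)"
          using c by (intro mult_left_mono) auto
        then show ?thesis using c\<epsilon> by (simp add: x_def)
      qed
      then have "c * (((r - s) * ln (real N))\<^sup>2 + (r - s) * ln (real N)) * (m + e N) \<le> 1 / 2 * (m + e N)"
        using V0 e_nonneg[OF N] by (intro mult_right_mono) auto
      ultimately show ?thesis by linarith
    qed
    \<comment> \<open>The bound holds for every \<open>r\<close> in the interval, hence for the
      supremum \<open>m\<close>, which is finite. Solving for \<open>m\<close> turns the coefficient
      2 into 4.\<close>
    then have "m \<le> 2 * u l s + 1 / 2 * (m + e N)"
      using st by (subst (1) m_def) (intro cSup_least, auto)
    then have "m \<le> 4 * u l s + e N" by argo
    moreover have "u l t \<le> m" by (rule V[OF st(2,3) order_refl])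
    moreover have "0 \<le> e N" by (rule e_nonneg[OF N])
    moreover have "0 \<le> u l s" by (rule nonneg[OF st(1)])
    ultimately show ?thesis by argo
  qed
  have iterate: "u l t + e N \<le> 4 ^ J * (u l s + e N)"
    if N: "real N > exp 1" and st: "s \<in> rat_times T" "t \<in> rat_times T" "s \<le> t"
      and len: "(t - s) * ln (real N) \<le> real J * \<epsilon>" for l N s t J
    using st(2,3) len
  proof (induction J arbitrary: t)
    case 0
    then have "t = s" using ln1[OF N] by (simp add: mult_le_0_iff)
    then show ?case by simp
  next
    case (Suc J)
    \<comment> \<open>The last of \<open>Suc J\<close> equal pieces is split off; the dividing ratio
      is rational, so \<open>m\<close> stays in \<open>rat_times T\<close>.\<close>
    define m where "m = s + (t - s) * (real J / real (Suc J))"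
    have m: "m \<in> rat_times T" "s \<le> m"
      unfolding m_def using rat_times_between[OF T st(1) Suc.prems(1,2), of J "Suc J"] Suc.prems(2) by auto
    have tm: "t - m = (t - s) / real (Suc J)" by (simp add: m_def field_simps)
    then have "m \<le> t" using Suc.prems(2) by (smt (verit) divide_nonneg_nonneg of_nat_0_le_iff)
    have "(t - m) * ln (real N) = (t - s) * ln (real N) / real (Suc J)" by (simp add: tm)
    also have "\<dots> \<le> \<epsilon>" using Suc.prems(3) by (simp add: field_simps)
    finally have 1: "(t - m) * ln (real N) \<le> \<epsilon>" .
    have "(m - s) * ln (real N) = (t - s) * ln (real N) * (real J / real (Suc J))" by (simp add: m_def)
    also have "\<dots> \<le> real (Suc J) * \<epsilon> * (real J / real (Suc J))"
      using Suc.prems(3) by (intro mult_right_mono) auto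
    also have "\<dots> = real J * \<epsilon>" by (simp del: of_nat_Suc)
    finally have 2: "(m - s) * ln (real N) \<le> real J * \<epsilon>" .
    have "u l t + e N \<le> 4 * (u l m + e N)"
      by (rule small[OF N m(1) Suc.prems(1) \<open>m \<le> t\<close> 1])
    also have "\<dots> \<le> 4 * (4 ^ J * (u l s + e N))"
      using Suc.IH[OF m 2] by simp
    finally show ?case by simp
  qed
  \<comment> \<open>A block of length \<open>\<rho>\<close> takes at most
    \<open>\<rho> * ln N / \<epsilon> + 1\<close> steps of factor 4, hence a total factor of at most
    \<open>4 * N powr (p / 2)\<close>. This uses up half of the exponent \<open>p\<close>, and the
    other half still sends the error to 0.\<close>
  define \<rho> where "\<rho> = p * \<epsilon> / (2 * ln 4)"
  have \<rho>: "0 < \<rho>" using p \<epsilon> by (simp add: \<rho>_def)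
  have block: "u l t \<le> 4 * real N powr (p / 2) * (u l s + e N)"
    if N: "real N > exp 1" and st: "s \<in> rat_times T" "t \<in> rat_times T" "s \<le> t" "t - s \<le> \<rho>" for l N s t
  proof -
    have L: "0 < ln (real N)" using ln1[OF N] by simp
    have N0: "0 < real N" using N exp_gt_zero[of 1] by linarith
    define J where "J = nat \<lceil>(t - s) * ln (real N) / \<epsilon>\<rceil>"
    have "0 \<le> (t - s) * ln (real N) / \<epsilon>" using st L \<epsilon> by simp
    then have J: "(t - s) * ln (real N) / \<epsilon> \<le> real J" "real J \<le> (t - s) * ln (real N) / \<epsilon> + 1"
      unfolding J_def by linarith+
    have "(t - s) * ln (real N) / \<epsilon> \<le> \<rho> * ln (real N) / \<epsilon>"
      using st L \<epsilon> by (intro divide_right_mono mult_right_mono) auto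
    also have "\<dots> = p / 2 * ln (real N) / ln 4" using \<epsilon> by (simp add: \<rho>_def)
    finally have "real J \<le> p / 2 * ln (real N) / ln 4 + 1" using J by simp
    then have "real J * ln 4 \<le> (p / 2 * ln (real N) / ln 4 + 1) * ln 4" by (intro mult_right_mono) auto
    then have "real J * ln 4 \<le> p / 2 * ln (real N) + ln 4" by (simp add: algebra_simps)
    then have "exp (real J * ln 4) \<le> exp (p / 2 * ln (real N)) * exp (ln 4)"
      by (simp only: exp_add[symmetric] exp_le_cancel_iff)
    moreover have "exp (real J * ln 4) = 4 ^ J" by (simp add: exp_of_nat_mult)
    moreover have "exp (p / 2 * ln (real N)) = real N powr (p / 2)" using N0 by (simp add: powr_def)
    ultimately have "4 ^ J \<le> 4 * real N powr (p / 2)" by (simp add: mult.commute)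
    moreover have "u l t + e N \<le> 4 ^ J * (u l s + e N)"
      using J(1) \<epsilon> by (intro iterate[OF N st(1-3)]) (simp add: field_simps)
    ultimately show ?thesis
      using mult_right_mono[of "4 ^ J" "4 * real N powr (p / 2)" "u l s + e N"] nonneg[OF st(1), of l] e_nonneg[OF N] by linarith
  qed
  have advance: "\<forall>\<^sub>F l in sequentially. \<forall>t\<in>rat_times T. t \<le> a + \<rho> \<longrightarrow> u l t \<le> \<eta>"
    if a: "a \<in> rat_times T" and hyp: "\<And>\<eta>. 0 < \<eta> \<Longrightarrow> \<forall>\<^sub>F l in sequentially. \<forall>t\<in>rat_times T. t \<le> a \<longrightarrow> u l t \<le> \<eta>"
      and \<eta>: "0 < \<eta>" for a \<eta>
  proof -
    \<comment> \<open>\<open>N\<close> is chosen first, to make the amplified error at most half of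
      the tolerance. The amplification \<open>k\<close> is then a fixed number, so the hypothesis at
      time \<open>a\<close> can be invoked with accuracy \<open>\<eta> / (2 * k)\<close>.\<close>
    have "(\<lambda>N. 4 * real N powr (p / 2) * (ln (real N) * real N powr - p)) \<longlonglongrightarrow> 0"
      using p by real_asymp
    then have "\<forall>\<^sub>F N in sequentially. 4 * real N powr (p / 2) * e N < \<eta> / 2"
      unfolding e_def using \<eta> by (intro order_tendstoD(2)) auto
    moreover have "\<forall>\<^sub>F N in sequentially. real N > exp 1" by real_asymp
    ultimately have "\<forall>\<^sub>F N in sequentially. 4 * real N powr (p / 2) * e N < \<eta> / 2 \<and> real N > exp 1"
      by (rule eventually_conj)
    then obtain N where N: "4 * real N powr (p / 2) * e N < \<eta> / 2" "real N > exp 1"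
      by (auto simp: eventually_sequentially)
    define k where "k = 4 * real N powr (p / 2)"
    have "0 < real N" using N(2) exp_gt_zero[of 1] by linarith
    then have k: "0 < k" by (simp add: k_def)
    have "\<forall>\<^sub>F l in sequentially. \<forall>t\<in>rat_times T. t \<le> a \<longrightarrow> u l t \<le> min \<eta> (\<eta> / (2 * k))"
      using \<eta> k by (intro hyp) auto
    then show ?thesis
    proof eventually_elim
      case (elim l)
      show ?case
      proof (intro ballI impI)
        fix t assume t: "t \<in> rat_times T" "t \<le> a + \<rho>"
        show "u l t \<le> \<eta>"
        proof (cases "t \<le> a")
          case True
          then show ?thesis using elim t by auto
        next
          case False
          have "u l a \<le> \<eta> / (2 * k)" using elim a by auto
          then have "k * u l a \<le> \<eta> / 2" using k by (simp add: field_simps)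
          moreover have "u l t \<le> k * (u l a + e N)"
            unfolding k_def using False t a by (intro block[OF N(2)]) auto
          ultimately show ?thesis using N(1) by (simp add: k_def algebra_simps)
        qed
      qed
    qed
  qed
  obtain n where n: "T / \<rho> < real n" using reals_Archimedean2 by blast
  have n0: "0 < n" using n T \<rho> by (metis divide_pos_pos gr0I less_asym of_nat_0)
  have Tn: "T / real n \<le> \<rho>" using n n0 \<rho> by (simp add: field_simps)
  \<comment> \<open>Each block demands a smaller accuracy from the preceding one, so
    \<open>\<eta>\<close> is generalised in the induction. The number \<open>n\<close> of blocks
    depends on neither \<open>N\<close> nor \<open>l\<close>.\<close>
  have "\<forall>\<^sub>F l in sequentially. \<forall>t\<in>rat_times T. t \<le> T * real k / real n \<longrightarrow> u l t \<le> \<eta>"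
    if "k \<le> n" "0 < \<eta>" for k \<eta>
    using that
  proof (induction k arbitrary: \<eta>)
    case 0
    have "\<forall>\<^sub>F l in sequentially. u l 0 < \<eta>"
      by (rule order_tendstoD(2)[OF init 0(2)])
    then show ?case
      by eventually_elim (auto simp: rat_times_def)
  next
    case (Suc k)
    have "\<forall>\<^sub>F l in sequentially. \<forall>t\<in>rat_times T. t \<le> T * real k / real n + \<rho> \<longrightarrow> u l t \<le> \<eta>"
      using Suc rat_times_fraction[OF T, of k n] n0 by (intro advance) auto
    moreover have "T * real (Suc k) / real n \<le> T * real k / real n + \<rho>"
      using Tn by (simp add: distrib_left add_divide_distrib)
    ultimately show ?case by (auto elim!: eventually_mono)
  qed
  from this[of n \<eta>] show ?thesis using \<eta> n0 by (auto simp: rat_times_def elim!: eventually_mono)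
qed

section \<open>Second moments\<close>

lemma rat_times_zero: "0 < T \<Longrightarrow> 0 \<in> rat_times T"
  by (simp add: rat_times_def)

lemma nat_fraction_of_rat:
  assumes "q \<in> \<rat>" "0 \<le> q"
  obtains i n :: nat where "0 < n" "q = real i / real n"
proof -
  obtain i n :: nat where "n \<noteq> 0" "\<bar>q\<bar> = real i / real n"
    using Rats_abs_nat_div_natE[OF assms(1)] by metis
  then show ?thesis using assms(2) that[of n i] by simp
qed

text \<open>A common denominator of the two ratios. That \<open>h / T\<close> is again rational
  keeps all refinements of this grid inside \<open>rat_times T\<close>.\<close>

lemma rat_times_common_step:
  assumes T: "0 < T" and st: "s \<in> rat_times T" "t \<in> rat_times T" "s \<le> t"
  obtains h i j where "0 < h" "h / T \<in> \<rat>" "i \<le> j" "s = real i * h" "t = real j * h"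
proof -
  have Q: "s / T \<in> \<rat>" "0 \<le> s / T" "t / T \<in> \<rat>" "0 \<le> t / T"
    using st T by (auto simp: rat_times_def)
  obtain a n where s: "0 < n" "s / T = real a / real n"
    by (rule nat_fraction_of_rat[OF Q(1,2)])
  obtain c k where t: "0 < k" "t / T = real c / real k"
    by (rule nat_fraction_of_rat[OF Q(3,4)])
  define h where "h = T / (real n * real k)"
  have h: "0 < h" using s t T by (simp add: h_def)
  have sh: "s = real (a * k) * h" and th: "t = real (c * n) * h"
    using s t T by (simp_all add: h_def field_simps)
  have "real (a * k) \<le> real (c * n)"
    using st(3) h unfolding sh th by (simp only: mult_le_cancel_right_pos)
  then have "a * k \<le> c * n" by (simp only: of_nat_le_iff)
  moreover have "h / T = 1 / (real n * real k)" using T by (simp add: h_def)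
  then have "h / T \<in> \<rat>" by simp
  ultimately show ?thesis using that h sh th by blast
qed

text \<open>Returns from Fatou bounds to real expectations. As \<open>ennreal\<close> sends negative
  reals to 0, the condition \<open>0 \<le> R\<close> is what lets the bound be read back in the
  reals.\<close>

lemma (in prob_space) sq_moment_of_nn_bound:
  fixes f :: "'a \<Rightarrow> 'b::{banach, second_countable_topology}"
  assumes [measurable]: "f \<in> borel_measurable M"
    and le: "(\<integral>\<^sup>+\<omega>. ennreal ((norm (f \<omega>))\<^sup>2) \<partial>M) \<le> ennreal R" and R: "0 \<le> R"
  shows "integrable M (\<lambda>\<omega>. (norm (f \<omega>))\<^sup>2)" and "expectation (\<lambda>\<omega>. (norm (f \<omega>))\<^sup>2) \<le> R"
proof -
  show i: "integrable M (\<lambda>\<omega>. (norm (f \<omega>))\<^sup>2)"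
    using le by (intro integrableI_bounded) (auto simp: order_le_less_trans[OF le])
  have "ennreal (expectation (\<lambda>\<omega>. (norm (f \<omega>))\<^sup>2)) \<le> ennreal R"
    using le nn_integral_eq_integral[OF i] by simp
  then show "expectation (\<lambda>\<omega>. (norm (f \<omega>))\<^sup>2) \<le> R"
    using R by (simp add: ennreal_le_iff)
qed

text \<open>If the square is not integrable, its integral has the default value 0, and the bound
  persists.\<close>

lemma (in prob_space) bounded_sq_expectation:
  fixes f :: "'a \<Rightarrow> 'b::real_normed_vector"
  assumes "\<And>\<omega>. norm (f \<omega>) \<le> K"
  shows "expectation (\<lambda>\<omega>. (norm (f \<omega>))\<^sup>2) \<le> K\<^sup>2"
proof (cases "integrable M (\<lambda>\<omega>. (norm (f \<omega>))\<^sup>2)")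
  case True
  have "expectation (\<lambda>\<omega>. (norm (f \<omega>))\<^sup>2) \<le> expectation (\<lambda>\<omega>. K\<^sup>2)"
    using True assms by (intro integral_mono) (auto intro!: power_mono)
  then show ?thesis by (simp add: prob_space)
qed (simp add: not_integrable_integral_eq)

section \<open>Second moments at rational times\<close>

context ito_process
begin

lemma increment_sq_moment:
  assumes T: "0 < T" and st: "s \<in> rat_times T" "t \<in> rat_times T" "s \<le> t"
    and B: "\<And>r. r \<in> rat_times T \<Longrightarrow> s \<le> r \<Longrightarrow> r \<le> t \<Longrightarrow> expectation (\<lambda>\<omega>. (norm (\<beta> r \<omega>))\<^sup>2) \<le> B"
    and Q: "\<And>r. r \<in> rat_times T \<Longrightarrow> s \<le> r \<Longrightarrow> r \<le> t \<Longrightarrow> expectation (\<lambda>\<omega>. (norm (H r \<omega>))\<^sup>2) \<le> Q"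
  shows "integrable M (\<lambda>\<omega>. (norm (Y t \<omega> - Y s \<omega>))\<^sup>2)" (is ?int)
    and "expectation (\<lambda>\<omega>. (norm (Y t \<omega> - Y s \<omega>))\<^sup>2) \<le> 2 * (t - s)\<^sup>2 * B + 8 * real CARD('m) * (t - s) * Q" (is ?le)
proof -
  obtain h i0 i1 where h: "0 < h" "h / T \<in> \<rat>" and i: "i0 \<le> i1"
    and eq: "s = real i0 * h" "t = real i1 * h"
    by (rule rat_times_common_step[OF T st])
  \<comment> \<open>Every refinement of the grid stays within the rational times between
    \<open>s\<close> and \<open>t\<close>, so the hypotheses \<open>B\<close> and \<open>Q\<close>
    cover all sample points.\<close>
  have r: "real k * (h / real n) \<in> rat_times T" "s \<le> real k * (h / real n)" "real k * (h / real n) \<le> t"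
    if "0 < n" "i0 * n \<le> k" "k < i1 * n" for n k :: nat
  proof -
    have "real (i0 * n) \<le> real k" "real k \<le> real (i1 * n)" using that by (simp_all only: of_nat_le_iff less_imp_le)
    then have le: "real (i0 * n) * (h / real n) \<le> real k * (h / real n)"
       "real k * (h / real n) \<le> real (i1 * n) * (h / real n)"
      using h(1) by (intro mult_right_mono; simp)+
    then show 1: "s \<le> real k * (h / real n)" "real k * (h / real n) \<le> t"
      using that(1) unfolding eq by simp_all
    have "real k * (h / real n) / T = real k / real n * (h / T)" by simp
    then have "real k * (h / real n) / T \<in> \<rat>" using h(2) by (simp only: Rats_mult Rats_divide Rats_of_nat)
    then show "real k * (h / real n) \<in> rat_times T"
      using 1 st by (auto simp: rat_times_def)
  qed
  have ts: "real (i1 - i0) * h = t - s" using i by (simp add: eq of_nat_diff left_diff_distrib)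
  have "0 \<le> expectation (\<lambda>\<omega>. (norm (\<beta> s \<omega>))\<^sup>2)" "0 \<le> expectation (\<lambda>\<omega>. (norm (H s \<omega>))\<^sup>2)"
    by simp_all
  then have BQ: "0 \<le> B" "0 \<le> Q"
    using B[OF st(1) order_refl st(3)] Q[OF st(1) order_refl st(3)] by linarith+
  have "(\<integral>\<^sup>+\<omega>. ennreal ((norm (Y t \<omega> - Y s \<omega>))\<^sup>2) \<partial>M)
      \<le> (\<integral>\<^sup>+\<omega>. ennreal (MAX i\<in>{i0..i1}. (norm (Y (real i * h) \<omega> - Y (real i0 * h) \<omega>))\<^sup>2) \<partial>M)"
    unfolding eq using i by (intro nn_integral_mono ennreal_leI Max_ge) auto
  also have "\<dots> \<le> ennreal (2 * (t - s)\<^sup>2 * B + 8 * real CARD('m) * (t - s) * Q)"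
    unfolding ts[symmetric] using r by (intro ito_max_increment h i B Q) auto
  finally have nn: "(\<integral>\<^sup>+\<omega>. ennreal ((norm (Y t \<omega> - Y s \<omega>))\<^sup>2) \<partial>M)
      \<le> ennreal (2 * (t - s)\<^sup>2 * B + 8 * real CARD('m) * (t - s) * Q)" .
  have m: "(\<lambda>\<omega>. Y t \<omega> - Y s \<omega>) \<in> borel_measurable M"
    using st by (intro borel_measurable_diff measurable_at_time) (auto simp: rat_times_def)
  have "0 \<le> 2 * (t - s)\<^sup>2 * B + 8 * real CARD('m) * (t - s) * Q"
    using BQ st(3) by (intro add_nonneg_nonneg mult_nonneg_nonneg) auto
  from sq_moment_of_nn_bound[OF m nn this] show ?int ?le by auto
qed

text \<open>A crude a priori bound from the boundedness of the coefficients. It feeds Chebyshev's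
  inequality and supplies the uniform bound \<open>U\<close> of
  \<open>logarithmic_gronwall\<close>.\<close>

lemma sq_moment:
  assumes T: "0 < T" and t: "t \<in> rat_times T"
  shows "integrable M (\<lambda>\<omega>. (norm (Y t \<omega>))\<^sup>2)" (is ?int)
    and "expectation (\<lambda>\<omega>. (norm (Y t \<omega>))\<^sup>2)
      \<le> 2 * (norm y\<^sub>0)\<^sup>2 + 2 * (2 * T\<^sup>2 * K\<^sup>2 + 8 * real CARD('m) * T * K\<^sup>2)" (is ?le)
proof -
  have t': "0 \<le> t" "t \<le> T" using t by (auto simp: rat_times_def)
  note inc = increment_sq_moment[OF T rat_times_zero[OF T] t t'(1),
      OF bounded_sq_expectation[OF \<beta>_bound] bounded_sq_expectation[OF H_bound]]
  have AE: "AE \<omega> in M. (norm (Y t \<omega>))\<^sup>2 \<le> 2 * (norm (Y t \<omega> - Y 0 \<omega>))\<^sup>2 + 2 * (norm y\<^sub>0)\<^sup>2"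
    using Y_0
  proof eventually_elim
    case (elim \<omega>)
    then show ?case using norm_add_sq_le[of "Y t \<omega> - Y 0 \<omega>" "y\<^sub>0"] by simp
  qed
  have i: "integrable M (\<lambda>\<omega>. 2 * (norm (Y t \<omega> - Y 0 \<omega>))\<^sup>2 + 2 * (norm y\<^sub>0)\<^sup>2)"
    using inc(1) by simp
  have [measurable]: "Y t \<in> borel_measurable M" using t' by simp
  show ?int
    by (rule Bochner_Integration.integrable_bound[OF i]) (use AE in auto)
  then have "expectation (\<lambda>\<omega>. (norm (Y t \<omega>))\<^sup>2) \<le> expectation (\<lambda>\<omega>. 2 * (norm (Y t \<omega> - Y 0 \<omega>))\<^sup>2 + 2 * (norm y\<^sub>0)\<^sup>2)"
    using i AE by (intro integral_mono_AE) auto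
  also have "\<dots> = 2 * expectation (\<lambda>\<omega>. (norm (Y t \<omega> - Y 0 \<omega>))\<^sup>2) + 2 * (norm y\<^sub>0)\<^sup>2"
    using inc(1) by (simp add: prob_space)
  also have "\<dots> \<le> 2 * (2 * T\<^sup>2 * K\<^sup>2 + 8 * real CARD('m) * T * K\<^sup>2) + 2 * (norm y\<^sub>0)\<^sup>2"
  proof -
    have "2 * (t - 0)\<^sup>2 * K\<^sup>2 + 8 * real CARD('m) * (t - 0) * K\<^sup>2 \<le> 2 * T\<^sup>2 * K\<^sup>2 + 8 * real CARD('m) * T * K\<^sup>2"
      using t' by (intro add_mono mult_right_mono mult_left_mono power_mono) auto
    from order_trans[OF inc(2) this] show ?thesis
      by (intro add_right_mono mult_left_mono) simp_all
  qed
  finally show ?le by simp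
qed

text \<open>Restarting the estimate at \<open>s\<close> costs a factor 2 on the value there; this is
  the shape of the hypothesis \<open>step\<close> in \<open>logarithmic_gronwall\<close>.\<close>

lemma sq_moment_step:
  assumes T: "0 < T" and st: "s \<in> rat_times T" "t \<in> rat_times T" "s \<le> t"
    and B: "\<And>r. r \<in> rat_times T \<Longrightarrow> s \<le> r \<Longrightarrow> r \<le> t \<Longrightarrow> expectation (\<lambda>\<omega>. (norm (\<beta> r \<omega>))\<^sup>2) \<le> B"
    and Q: "\<And>r. r \<in> rat_times T \<Longrightarrow> s \<le> r \<Longrightarrow> r \<le> t \<Longrightarrow> expectation (\<lambda>\<omega>. (norm (H r \<omega>))\<^sup>2) \<le> Q"
  shows "expectation (\<lambda>\<omega>. (norm (Y t \<omega>))\<^sup>2) \<le> 2 * expectation (\<lambda>\<omega>. (norm (Y s \<omega>))\<^sup>2)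
      + 2 * (2 * (t - s)\<^sup>2 * B + 8 * real CARD('m) * (t - s) * Q)"
proof -
  have inc: "integrable M (\<lambda>\<omega>. (norm (Y t \<omega> - Y s \<omega>))\<^sup>2)"
    "expectation (\<lambda>\<omega>. (norm (Y t \<omega> - Y s \<omega>))\<^sup>2) \<le> 2 * (t - s)\<^sup>2 * B + 8 * real CARD('m) * (t - s) * Q"
    by (rule increment_sq_moment[OF T st], fact B, fact Q)+
  have "expectation (\<lambda>\<omega>. (norm (Y t \<omega>))\<^sup>2)
      \<le> expectation (\<lambda>\<omega>. 2 * (norm (Y s \<omega>))\<^sup>2 + 2 * (norm (Y t \<omega> - Y s \<omega>))\<^sup>2)"
  proof (intro integral_mono Bochner_Integration.integrable_add integrable_mult_right inc(1) sq_moment(1)[OF T] st)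
    show "(norm (Y t \<omega>))\<^sup>2 \<le> 2 * (norm (Y s \<omega>))\<^sup>2 + 2 * (norm (Y t \<omega> - Y s \<omega>))\<^sup>2" for \<omega>
      using norm_add_sq_le[of "Y s \<omega>" "Y t \<omega> - Y s \<omega>"] by simp
  qed
  also have "\<dots> = 2 * expectation (\<lambda>\<omega>. (norm (Y s \<omega>))\<^sup>2) + 2 * expectation (\<lambda>\<omega>. (norm (Y t \<omega> - Y s \<omega>))\<^sup>2)"
    using inc(1) sq_moment(1)[OF T st(1)] by simp
  also have "\<dots> \<le> 2 * expectation (\<lambda>\<omega>. (norm (Y s \<omega>))\<^sup>2)
      + 2 * (2 * (t - s)\<^sup>2 * B + 8 * real CARD('m) * (t - s) * Q)"
    using inc(2) by (intro add_left_mono mult_left_mono) simp_all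
  finally show ?thesis .
qed

end

text \<open>The supremum is attained at some \<open>t\<close>, and \<open>f\<close> at the nearest
  grid point to the left of \<open>t\<close> converges to it while staying below the grid
  maximum.\<close>

lemma SUP_le_liminf_grid_max:
  fixes f :: "real \<Rightarrow> real"
  assumes T: "0 < T" and f: "continuous_on {0..T} f"
  shows "ennreal (SUP t\<in>{0..T}. f t) \<le> liminf (\<lambda>n. ennreal (MAX i\<in>{0..n}. f (real i * (T / real n))))"
proof -
  obtain t where t: "t \<in> {0..T}" "\<And>s. s \<in> {0..T} \<Longrightarrow> f s \<le> f t"
    using continuous_attains_sup[of "{0..T}" f] f T by auto
  have sup: "(SUP s\<in>{0..T}. f s) = f t"
    by (rule cSup_eq_maximum) (use t in auto)
  \<comment> \<open>The index of the last grid point not exceeding \<open>t\<close>.\<close>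
  define j where "j = (\<lambda>n::nat. nat \<lfloor>t * real n / T\<rfloor>)"
  have j: "real (j n) \<le> t * real n / T" "t * real n / T < real (j n) + 1" for n
  proof -
    have "0 \<le> t * real n / T" using t T by simp
    then show "real (j n) \<le> t * real n / T" "t * real n / T < real (j n) + 1"
      unfolding j_def by linarith+
  qed
  have jn: "j n \<le> n" for n
  proof -
    have "t * real n \<le> T * real n" using t by (intro mult_right_mono) auto
    then have "t * real n / T \<le> real n" using T by (simp add: field_simps)
    then show ?thesis using j(1)[of n] by linarith
  qed
  have le: "real (j n) * (T / real n) \<le> t" "t - T / real n \<le> real (j n) * (T / real n)" if "0 < n" for n
  proof -
    have "t * real n \<le> T + T * real (j n)" using j(2)[of n] T by (simp add: field_simps)
    then have "t \<le> (T + T * real (j n)) / real n" using that by (simp add: pos_le_divide_eq)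
    then show "t - T / real n \<le> real (j n) * (T / real n)" by (simp add: add_divide_distrib mult.commute)
    show "real (j n) * (T / real n) \<le> t" using j(1)[of n] that T by (simp add: field_simps)
  qed
  have "(\<lambda>n. real (j n) * (T / real n)) \<longlonglongrightarrow> t"
  proof (rule tendsto_sandwich)
    show "(\<lambda>n. t - T / real n) \<longlonglongrightarrow> t" by real_asymp
    show "\<forall>\<^sub>F n in sequentially. t - T / real n \<le> real (j n) * (T / real n)"
      "\<forall>\<^sub>F n in sequentially. real (j n) * (T / real n) \<le> t"
      using le by (auto simp: eventually_sequentially intro!: exI[of _ 1])
  qed simp
  moreover have "\<forall>\<^sub>F n in sequentially. real (j n) * (T / real n) \<in> {0..T}"
    unfolding eventually_sequentially
  proof (intro exI[of _ 1] allI impI)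
    fix n :: nat assume "1 \<le> n"
    then show "real (j n) * (T / real n) \<in> {0..T}"
      using le(1)[of n] t T by (auto intro: order_trans)
  qed
  ultimately have "(\<lambda>n. f (real (j n) * (T / real n))) \<longlonglongrightarrow> f t"
    by (rule continuous_on_tendsto_compose[OF f _ t(1)])
  then have "(\<lambda>n. ennreal (f (real (j n) * (T / real n)))) \<longlonglongrightarrow> ennreal (f t)"
    by (rule tendsto_ennrealI)
  then have "ennreal (f t) = liminf (\<lambda>n. ennreal (f (real (j n) * (T / real n))))"
    by (rule lim_imp_Liminf[OF trivial_limit_sequentially, symmetric])
  also have "\<dots> \<le> liminf (\<lambda>n. ennreal (MAX i\<in>{0..n}. f (real i * (T / real n))))"
    using jn by (intro Liminf_mono always_eventually allI ennreal_leI Max_ge) auto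
  finally show ?thesis by (simp add: sup)
qed

text \<open>The maximal estimate holds on every uniform grid with the same right-hand side. Path
  continuity and Fatou's lemma transfer it to the supremum, which enters only through monotonicity
  of the nonnegative integral; measurability is asked of the grid maxima. The initial value is split
  off by one more factor 2.\<close>

lemma (in ito_process) sup_sq_bound:
  assumes T: "0 < T"
    and Y_cont: "\<And>\<omega>. \<omega> \<in> space M \<Longrightarrow> continuous_on {0..} (\<lambda>t. Y t \<omega>)"
    and B: "\<And>r. r \<in> rat_times T \<Longrightarrow> (\<integral>\<omega>. (norm (\<beta> r \<omega>))\<^sup>2 \<partial>M) \<le> B"
    and Q: "\<And>r. r \<in> rat_times T \<Longrightarrow> (\<integral>\<omega>. (norm (H r \<omega>))\<^sup>2 \<partial>M) \<le> Q"
  shows "(\<integral>\<^sup>+\<omega>. ennreal (SUP t\<in>{0..T}. (norm (Y t \<omega>))\<^sup>2) \<partial>M)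
    \<le> ennreal (2 * (norm y\<^sub>0)\<^sup>2 + 2 * (2 * T\<^sup>2 * B + 8 * real CARD('m) * T * Q))"
    (is "_ \<le> ennreal ?R")
proof -
  define V where "V = (\<lambda>n \<omega>. MAX i\<in>{0..n}. (norm (Y (real i * (T / real n)) \<omega>))\<^sup>2)"
  have V_meas: "V n \<in> borel_measurable M" for n
  proof -
    have [measurable]: "Y (real i * (T / real n)) \<in> borel_measurable M" for i using T by simp
    show ?thesis unfolding V_def by measurable
  qed
  have "0 \<le> (\<integral>\<omega>. (norm (\<beta> 0 \<omega>))\<^sup>2 \<partial>M)" "0 \<le> (\<integral>\<omega>. (norm (H 0 \<omega>))\<^sup>2 \<partial>M)" by simp_all
  then have BQ: "0 \<le> B" "0 \<le> Q"
    using B[OF rat_times_zero[OF T]] Q[OF rat_times_zero[OF T]] by linarith+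
  have V_le: "(\<integral>\<^sup>+\<omega>. ennreal (V n \<omega>) \<partial>M) \<le> ennreal ?R" if n: "0 < n" for n
  proof -
    define h where "h = T / real n"
    have h: "0 < h" using n T by (simp add: h_def)
    define Z where "Z = (\<lambda>\<omega>. MAX i\<in>{0..n}. (norm (Y (real i * h) \<omega> - Y (real 0 * h) \<omega>))\<^sup>2)"
    have r: "real k * (h / real m) \<in> rat_times T" if "0 < m" "k < n * m" for k m
    proof -
      have "real k * (h / real m) = T * real k / real (n * m)" by (simp add: h_def)
      then show ?thesis using rat_times_fraction[OF T, of k "n * m"] that n by simp
    qed
    have "(\<integral>\<^sup>+\<omega>. ennreal (Z \<omega>) \<partial>M) \<le> ennreal (2 * (real (n - 0) * h)\<^sup>2 * B + 8 * real CARD('m) * (real (n - 0) * h) * Q)"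
      unfolding Z_def using r by (intro ito_max_increment h B Q) auto
    then have Z_le: "(\<integral>\<^sup>+\<omega>. ennreal (Z \<omega>) \<partial>M) \<le> ennreal (2 * T\<^sup>2 * B + 8 * real CARD('m) * T * Q)"
      using n by (simp add: h_def)
    have Z_nonneg: "0 \<le> Z \<omega>" for \<omega>
      unfolding Z_def by (rule order_trans[OF zero_le_power2 Max_ge[OF _ imageI[of 0]]]) auto
    have Z_meas: "Z \<in> borel_measurable M"
    proof -
      have [measurable]: "Y (real i * h) \<in> borel_measurable M" for i using h by simp
      show ?thesis unfolding Z_def by measurable
    qed
    have "(\<integral>\<^sup>+\<omega>. ennreal (V n \<omega>) \<partial>M) \<le> (\<integral>\<^sup>+\<omega>. ennreal (2 * (norm y\<^sub>0)\<^sup>2) + 2 * ennreal (Z \<omega>) \<partial>M)"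
    proof (rule nn_integral_mono_AE)
      show "AE \<omega> in M. ennreal (V n \<omega>) \<le> ennreal (2 * (norm y\<^sub>0)\<^sup>2) + 2 * ennreal (Z \<omega>)"
        using Y_0
      proof eventually_elim
        case (elim \<omega>)
        have "V n \<omega> \<le> 2 * (norm y\<^sub>0)\<^sup>2 + 2 * Z \<omega>"
          unfolding V_def
        proof (intro Max.boundedI)
          fix v assume "v \<in> (\<lambda>i. (norm (Y (real i * (T / real n)) \<omega>))\<^sup>2) ` {0..n}"
          then obtain i where i: "i \<in> {0..n}" and v: "v = (norm (Y (real i * h) \<omega>))\<^sup>2"
            by (auto simp: h_def)
          have "(norm (Y (real i * h) \<omega> - Y (real 0 * h) \<omega>))\<^sup>2 \<le> Z \<omega>"
            unfolding Z_def using i by (intro Max_ge) auto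
          then show "v \<le> 2 * (norm y\<^sub>0)\<^sup>2 + 2 * Z \<omega>"
            using norm_add_sq_le[of "y\<^sub>0" "Y (real i * h) \<omega> - Y (real 0 * h) \<omega>"] elim by (simp add: v)
        qed auto
        then have "ennreal (V n \<omega>) \<le> ennreal (2 * (norm y\<^sub>0)\<^sup>2 + 2 * Z \<omega>)" by (rule ennreal_leI)
        also have "\<dots> = ennreal (2 * (norm y\<^sub>0)\<^sup>2) + 2 * ennreal (Z \<omega>)"
          using Z_nonneg by (simp add: ennreal_plus ennreal_mult)
        finally show ?case .
      qed
    qed
    also have "\<dots> = ennreal (2 * (norm y\<^sub>0)\<^sup>2) + 2 * (\<integral>\<^sup>+\<omega>. ennreal (Z \<omega>) \<partial>M)"
      using Z_meas by (simp add: nn_integral_add nn_integral_cmult emeasure_space_1)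
    also have "\<dots> \<le> ennreal (2 * (norm y\<^sub>0)\<^sup>2) + 2 * ennreal (2 * T\<^sup>2 * B + 8 * real CARD('m) * T * Q)"
      using Z_le by (intro add_mono mult_left_mono) auto
    also have "\<dots> = ennreal ?R"
    proof -
      define x where "x = 2 * T\<^sup>2 * B + 8 * real CARD('m) * T * Q"
      have "0 \<le> x" using BQ T by (auto simp: x_def intro!: add_nonneg_nonneg mult_nonneg_nonneg)
      then have "ennreal (2 * (norm y\<^sub>0)\<^sup>2) + 2 * ennreal x = ennreal (2 * (norm y\<^sub>0)\<^sup>2 + 2 * x)"
        by (simp add: ennreal_plus ennreal_mult)
      then show ?thesis unfolding x_def .
    qed
    finally show ?thesis .
  qed
  have "(\<integral>\<^sup>+\<omega>. ennreal (SUP t\<in>{0..T}. (norm (Y t \<omega>))\<^sup>2) \<partial>M) \<le> (\<integral>\<^sup>+\<omega>. liminf (\<lambda>n. ennreal (V n \<omega>)) \<partial>M)"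
    unfolding V_def
    by (intro nn_integral_mono SUP_le_liminf_grid_max[OF T] continuous_intros continuous_on_subset[OF Y_cont]) auto
  also have "\<dots> \<le> liminf (\<lambda>n. \<integral>\<^sup>+\<omega>. ennreal (V n \<omega>) \<partial>M)"
    by (intro nn_integral_liminf measurable_compose[OF V_meas] measurable_ennreal)
  also have "\<dots> \<le> ennreal ?R"
  proof (rule Liminf_le[OF trivial_limit_sequentially])
    show "\<forall>\<^sub>F n in sequentially. (\<integral>\<^sup>+\<omega>. ennreal (V n \<omega>) \<partial>M) \<le> ennreal ?R"
      unfolding eventually_sequentially by (intro exI[of _ 1] allI impI V_le) simp
  qed
  finally show ?thesis .
qed

section \<open>Solutions of the stochastic differential equation\<close>

text \<open>Riemann sums are linear in the integrand, and a deviation above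
  \<open>\<epsilon>\<close> of the difference forces one above \<open>\<epsilon> / 2\<close> in one
  of the two terms.\<close>

lemma (in brownian_filtration) is_ito_integral_diff:
  fixes H1 H2 :: "real \<Rightarrow> 'a \<Rightarrow> real^'m^'d"
  assumes H1: "\<And>s. 0 \<le> s \<Longrightarrow> H1 s \<in> borel_measurable M" and H2: "\<And>s. 0 \<le> s \<Longrightarrow> H2 s \<in> borel_measurable M"
    and t: "0 \<le> t" and I: "is_ito_integral M W H1 t I1" "is_ito_integral M W H2 t I2"
  shows "is_ito_integral M W (\<lambda>s \<omega>. H1 s \<omega> - H2 s \<omega>) t (\<lambda>\<omega>. I1 \<omega> - I2 \<omega>)"
proof -
  have [measurable]: "I1 \<in> borel_measurable M" "I2 \<in> borel_measurable M"
    using I by (auto simp: is_ito_integral_def)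
  define S where "S = (\<lambda>(H :: real \<Rightarrow> 'a \<Rightarrow> real^'m^'d) n \<omega>. \<Sum>k<n. H (real k * t / real n) \<omega> *v
      (W (real (Suc k) * t / real n) \<omega> - W (real k * t / real n) \<omega>))"
  have S_meas: "S H n \<in> borel_measurable M" if "\<And>s. 0 \<le> s \<Longrightarrow> H s \<in> borel_measurable M" for H n
    unfolding S_def using t
    by (intro borel_measurable_sum borel_measurable_matrix_vector_mult borel_measurable_diff that W_measurable) auto
  have [measurable]: "S H1 n \<in> borel_measurable M" "S H2 n \<in> borel_measurable M" for n
    using S_meas H1 H2 by auto
  have lim: "(\<lambda>n. prob {\<omega> \<in> space M. \<epsilon> < norm (S H1 n \<omega> - I1 \<omega>)}) \<longlonglongrightarrow> 0"
    "(\<lambda>n. prob {\<omega> \<in> space M. \<epsilon> < norm (S H2 n \<omega> - I2 \<omega>)}) \<longlonglongrightarrow> 0" if "0 < \<epsilon>" for \<epsilon>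
    using I that unfolding is_ito_integral_def S_def by auto
  have S_diff: "S (\<lambda>s \<omega>. H1 s \<omega> - H2 s \<omega>) n \<omega> = S H1 n \<omega> - S H2 n \<omega>" for n \<omega>
    unfolding S_def by (simp add: matrix_vector_mult_diff_rdistrib sum_subtractf)
  have "(\<lambda>n. prob {\<omega> \<in> space M. \<epsilon> < norm (S (\<lambda>s \<omega>. H1 s \<omega> - H2 s \<omega>) n \<omega> - (I1 \<omega> - I2 \<omega>))}) \<longlonglongrightarrow> 0"
    if \<epsilon>: "0 < \<epsilon>" for \<epsilon>
  proof (rule tendsto_sandwich[OF _ _ tendsto_const])
    let ?A = "\<lambda>n. {\<omega> \<in> space M. \<epsilon> / 2 < norm (S H1 n \<omega> - I1 \<omega>)}"
    let ?B = "\<lambda>n. {\<omega> \<in> space M. \<epsilon> / 2 < norm (S H2 n \<omega> - I2 \<omega>)}"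
    show "(\<lambda>n. prob (?A n) + prob (?B n)) \<longlonglongrightarrow> 0"
      using tendsto_add[OF lim(1) lim(2), of "\<epsilon> / 2" "\<epsilon> / 2"] \<epsilon> by simp
    have "prob {\<omega> \<in> space M. \<epsilon> < norm (S (\<lambda>s \<omega>. H1 s \<omega> - H2 s \<omega>) n \<omega> - (I1 \<omega> - I2 \<omega>))} \<le> prob (?A n) + prob (?B n)" for n
    proof -
      have "{\<omega> \<in> space M. \<epsilon> < norm (S (\<lambda>s \<omega>. H1 s \<omega> - H2 s \<omega>) n \<omega> - (I1 \<omega> - I2 \<omega>))} \<subseteq> ?A n \<union> ?B n"
      proof
        fix \<omega> assume \<omega>: "\<omega> \<in> {\<omega> \<in> space M. \<epsilon> < norm (S (\<lambda>s \<omega>. H1 s \<omega> - H2 s \<omega>) n \<omega> - (I1 \<omega> - I2 \<omega>))}"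
        have "norm (S H1 n \<omega> - S H2 n \<omega> - (I1 \<omega> - I2 \<omega>)) \<le> norm (S H1 n \<omega> - I1 \<omega>) + norm (S H2 n \<omega> - I2 \<omega>)"
          by (rule order_trans[OF _ norm_triangle_ineq4]) (simp add: algebra_simps)
        then show "\<omega> \<in> ?A n \<union> ?B n"
          using \<omega> by (auto simp: S_diff)
      qed
      then have "prob {\<omega> \<in> space M. \<epsilon> < norm (S (\<lambda>s \<omega>. H1 s \<omega> - H2 s \<omega>) n \<omega> - (I1 \<omega> - I2 \<omega>))} \<le> prob (?A n \<union> ?B n)"
        by (rule finite_measure_mono) measurable
      also have "\<dots> \<le> prob (?A n) + prob (?B n)" by (rule measure_Un_le) measurable
      finally show ?thesis .
    qed
    then show "\<forall>\<^sub>F n in sequentially. prob {\<omega> \<in> space M. \<epsilon> < norm (S (\<lambda>s \<omega>. H1 s \<omega> - H2 s \<omega>) n \<omega> - (I1 \<omega> - I2 \<omega>))}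
        \<le> prob (?A n) + prob (?B n)" by simp
  qed simp
  then show ?thesis unfolding is_ito_integral_def S_def by simp
qed

section \<open>Solutions and their differences as Ito processes\<close>

locale bounded_sde = brownian_filtration M F W
  for M :: "'a measure" and F and W :: "real \<Rightarrow> 'a \<Rightarrow> real^'m" +
  fixes \<sigma> :: "real^'d \<Rightarrow> real^'m^'d" and b :: "real^'d \<Rightarrow> real^'d" and K :: real
  assumes \<sigma>_cont: "continuous_on UNIV \<sigma>" and b_cont: "continuous_on UNIV b"
    and \<sigma>_bound: "\<And>y. norm (\<sigma> y) \<le> K" and b_bound: "\<And>y. norm (b y) \<le> K"
begin

lemma solution_coefficients:
  assumes X: "sde_solution M F W b \<sigma> z X"
  shows "0 \<le> t \<Longrightarrow> X t \<in> borel_measurable M"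
    and "0 \<le> t \<Longrightarrow> (\<lambda>\<omega>. b (X t \<omega>)) \<in> borel_measurable M"
    and "0 \<le> t \<Longrightarrow> (\<lambda>\<omega>. \<sigma> (X t \<omega>)) \<in> borel_measurable (F t)"
    and "\<omega> \<in> space M \<Longrightarrow> continuous_on {0..} (\<lambda>t. b (X t \<omega>))"
proof -
  have XF: "X t \<in> borel_measurable (F t)" if "0 \<le> t" for t
    using X that by (auto simp: sde_solution_def)
  then show "0 \<le> t \<Longrightarrow> X t \<in> borel_measurable M" using measurable_F_M by blast
  then show "0 \<le> t \<Longrightarrow> (\<lambda>\<omega>. b (X t \<omega>)) \<in> borel_measurable M"
    by (rule measurable_compose) (use b_cont borel_measurable_continuous_onI in auto)
  show "0 \<le> t \<Longrightarrow> (\<lambda>\<omega>. \<sigma> (X t \<omega>)) \<in> borel_measurable (F t)"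
    by (rule measurable_compose[OF XF]) (use \<sigma>_cont borel_measurable_continuous_onI in auto)
  show "\<omega> \<in> space M \<Longrightarrow> continuous_on {0..} (\<lambda>t. b (X t \<omega>))"
    using X continuous_on_compose2[OF b_cont] by (auto simp: sde_solution_def)
qed

lemma solution_ito_process:
  assumes X: "sde_solution M F W b \<sigma> z X"
  shows "ito_process M F W (\<lambda>t \<omega>. b (X t \<omega>)) (\<lambda>t \<omega>. \<sigma> (X t \<omega>)) z X K"
  using solution_coefficients[OF X] \<sigma>_bound b_bound X
  by unfold_locales (auto simp: sde_solution_def)

text \<open>Both solutions are driven by the same \<open>W\<close>, so drifts, integrands and
  starting points subtract; the bound on the coefficients doubles.\<close>

lemma solution_difference_ito_process:
  assumes X: "sde_solution M F W b \<sigma> z X" and X': "sde_solution M F W b \<sigma> z' X'"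
  shows "ito_process M F W (\<lambda>t \<omega>. b (X t \<omega>) - b (X' t \<omega>)) (\<lambda>t \<omega>. \<sigma> (X t \<omega>) - \<sigma> (X' t \<omega>))
      (z - z') (\<lambda>t \<omega>. X t \<omega> - X' t \<omega>) (2 * K)"
proof unfold_locales
  have tri: "norm (u - v) \<le> 2 * K" if "norm u \<le> K" "norm v \<le> K" for u v :: "'c::real_normed_vector"
    using norm_triangle_ineq4[of u v] that by linarith
  show "norm (b (X t \<omega>) - b (X' t \<omega>)) \<le> 2 * K" "norm (\<sigma> (X t \<omega>) - \<sigma> (X' t \<omega>)) \<le> 2 * K" for t \<omega>
    by (intro tri \<sigma>_bound b_bound)+
  note c = solution_coefficients[OF X] and c' = solution_coefficients[OF X']
  show "continuous_on {0..} (\<lambda>t. b (X t \<omega>) - b (X' t \<omega>))" if "\<omega> \<in> space M" for \<omega>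
    using that by (intro continuous_on_diff c c')
  show "(\<lambda>\<omega>. b (X t \<omega>) - b (X' t \<omega>)) \<in> borel_measurable M" "(\<lambda>\<omega>. X t \<omega> - X' t \<omega>) \<in> borel_measurable M"
    "(\<lambda>\<omega>. \<sigma> (X t \<omega>) - \<sigma> (X' t \<omega>)) \<in> borel_measurable (F t)" if "0 \<le> t" for t
    using that by (intro borel_measurable_diff c c'; simp)+
  show "\<exists>I. is_ito_integral M W (\<lambda>s \<omega>. \<sigma> (X s \<omega>) - \<sigma> (X' s \<omega>)) t I \<and>
      (AE \<omega> in M. X t \<omega> - X' t \<omega> = z - z' + integral {0..t} (\<lambda>s. b (X s \<omega>) - b (X' s \<omega>)) + I \<omega>)"
    if t: "0 \<le> t" for t
  proof -
    obtain I where I: "is_ito_integral M W (\<lambda>s \<omega>. \<sigma> (X s \<omega>)) t I"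
      and eq: "AE \<omega> in M. X t \<omega> = z + integral {0..t} (\<lambda>s. b (X s \<omega>)) + I \<omega>"
      using X t unfolding sde_solution_def by blast
    obtain I' where I': "is_ito_integral M W (\<lambda>s \<omega>. \<sigma> (X' s \<omega>)) t I'"
      and eq': "AE \<omega> in M. X' t \<omega> = z' + integral {0..t} (\<lambda>s. b (X' s \<omega>)) + I' \<omega>"
      using X' t unfolding sde_solution_def by blast
    have "is_ito_integral M W (\<lambda>s \<omega>. \<sigma> (X s \<omega>) - \<sigma> (X' s \<omega>)) t (\<lambda>\<omega>. I \<omega> - I' \<omega>)"
      using c(3) c'(3) measurable_F_M by (intro is_ito_integral_diff t I I') blast+
    moreover have "AE \<omega> in M. X t \<omega> - X' t \<omega>
        = z - z' + integral {0..t} (\<lambda>s. b (X s \<omega>) - b (X' s \<omega>)) + (I \<omega> - I' \<omega>)"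
      using eq eq' AE_space
    proof eventually_elim
      case (elim \<omega>)
      have "(\<lambda>s. b (X s \<omega>)) integrable_on {0..t}" "(\<lambda>s. b (X' s \<omega>)) integrable_on {0..t}"
        using c(4)[OF elim(3)] c'(4)[OF elim(3)]
        by (auto intro!: integrable_continuous_real elim: continuous_on_subset)
      then have "integral {0..t} (\<lambda>s. b (X s \<omega>) - b (X' s \<omega>))
          = integral {0..t} (\<lambda>s. b (X s \<omega>)) - integral {0..t} (\<lambda>s. b (X' s \<omega>))"
        by (rule Henstock_Kurzweil_Integration.integral_diff)
      then show ?case using elim by simp
    qed
    ultimately show ?thesis by (intro exI[of _ "\<lambda>\<omega>. I \<omega> - I' \<omega>"] conjI)
  qed
qed

end

text \<open>Outside the ball of radius \<open>N\<close> the boundedness of \<open>f\<close> is charged to \<open>(|y|\<^sup>2 + |z|\<^sup>2) / N\<^sup>2\<close>,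
  which makes a localisation by stopping times unnecessary.\<close>
lemma local_modulus_sq_bound:
  fixes f :: "'b::real_normed_vector \<Rightarrow> 'c::real_normed_vector"
  assumes K: "\<And>y. norm (f y) \<le> K" and N: "0 < N"
    and loc: "norm y \<le> N \<Longrightarrow> norm z \<le> N \<Longrightarrow> norm (f y - f z) \<le> A * norm (y - z) + B"
  shows "(norm (f y - f z))\<^sup>2 \<le> 2 * A\<^sup>2 * (norm (y - z))\<^sup>2 + 2 * B\<^sup>2 + 4 * K\<^sup>2 * (((norm y)\<^sup>2 + (norm z)\<^sup>2) / N\<^sup>2)"
proof (cases "norm y \<le> N \<and> norm z \<le> N")
  case True
  then have "(norm (f y - f z))\<^sup>2 \<le> (A * norm (y - z) + B)\<^sup>2"
    using loc by (intro power_mono) auto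
  also have "\<dots> \<le> 2 * (A * norm (y - z))\<^sup>2 + 2 * B\<^sup>2"
    using norm_add_sq_le[of "A * norm (y - z)" B] by simp
  finally have 1: "(norm (f y - f z))\<^sup>2 \<le> 2 * A\<^sup>2 * (norm (y - z))\<^sup>2 + 2 * B\<^sup>2"
    by (simp add: power_mult_distrib)
  have "0 \<le> 4 * K\<^sup>2 * (((norm y)\<^sup>2 + (norm z)\<^sup>2) / N\<^sup>2)" by simp
  with 1 show ?thesis by linarith
next
  case False
  have "N\<^sup>2 \<le> (norm y)\<^sup>2 + (norm z)\<^sup>2"
  proof -
    from False consider "N \<le> norm y" | "N \<le> norm z" by (meson linear)
    then show ?thesis
    proof cases
      case 1
      then have "N\<^sup>2 \<le> (norm y)\<^sup>2" using N by (intro power_mono) auto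
      then show ?thesis by (simp add: add_increasing2)
    next
      case 2
      then have "N\<^sup>2 \<le> (norm z)\<^sup>2" using N by (intro power_mono) auto
      then show ?thesis by (simp add: add_increasing)
    qed
  qed
  then have r: "1 \<le> ((norm y)\<^sup>2 + (norm z)\<^sup>2) / N\<^sup>2" using N by simp
  have "norm (f y - f z) \<le> 2 * K"
    using norm_triangle_ineq4[of "f y" "f z"] K[of y] K[of z] by linarith
  then have "(norm (f y - f z))\<^sup>2 \<le> (2 * K)\<^sup>2" by (intro power_mono) auto
  also have "\<dots> \<le> 4 * K\<^sup>2 * (((norm y)\<^sup>2 + (norm z)\<^sup>2) / N\<^sup>2)"
    using mult_left_mono[OF r, of "4 * K\<^sup>2"] by (simp add: power_mult_distrib)
  also have "\<dots> \<le> 2 * A\<^sup>2 * (norm (y - z))\<^sup>2 + 2 * B\<^sup>2 + \<dots>" by simp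
  finally show ?thesis .
qed

text \<open>The pointwise estimate integrated. Its last term is the Chebyshev contribution of the
  event that one of the two variables leaves the ball, with one \<open>U\<close> for each
  variable.\<close>

lemma (in prob_space) local_modulus_expectation:
  fixes f :: "'b::{real_normed_vector, second_countable_topology} \<Rightarrow> 'c::{real_normed_vector, second_countable_topology}"
  assumes f: "continuous_on UNIV f" and K: "\<And>y. norm (f y) \<le> K" and N: "0 < N"
    and loc: "\<And>y z. norm y \<le> N \<Longrightarrow> norm z \<le> N \<Longrightarrow> norm (f y - f z) \<le> A * norm (y - z) + B"
    and meas: "Y \<in> borel_measurable M" "Z \<in> borel_measurable M"
    and int: "integrable M (\<lambda>\<omega>. (norm (Y \<omega>))\<^sup>2)" "integrable M (\<lambda>\<omega>. (norm (Z \<omega>))\<^sup>2)"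
      "integrable M (\<lambda>\<omega>. (norm (Y \<omega> - Z \<omega>))\<^sup>2)"
    and U: "expectation (\<lambda>\<omega>. (norm (Y \<omega>))\<^sup>2) \<le> U" "expectation (\<lambda>\<omega>. (norm (Z \<omega>))\<^sup>2) \<le> U"
    and V: "expectation (\<lambda>\<omega>. (norm (Y \<omega> - Z \<omega>))\<^sup>2) \<le> V"
  shows "expectation (\<lambda>\<omega>. (norm (f (Y \<omega>) - f (Z \<omega>)))\<^sup>2) \<le> 2 * A\<^sup>2 * V + 2 * B\<^sup>2 + 8 * K\<^sup>2 * U / N\<^sup>2"
proof -
  let ?g = "\<lambda>\<omega>. 2 * A\<^sup>2 * (norm (Y \<omega> - Z \<omega>))\<^sup>2 + 2 * B\<^sup>2 + 4 * K\<^sup>2 * (((norm (Y \<omega>))\<^sup>2 + (norm (Z \<omega>))\<^sup>2) / N\<^sup>2)"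
  have le: "(norm (f (Y \<omega>) - f (Z \<omega>)))\<^sup>2 \<le> ?g \<omega>" for \<omega>
    using K N loc by (rule local_modulus_sq_bound)
  have [measurable]: "f \<in> borel_measurable borel" using f by (rule borel_measurable_continuous_onI)
  note [measurable] = meas
  have g: "integrable M ?g" using int by simp
  have "integrable M (\<lambda>\<omega>. (norm (f (Y \<omega>) - f (Z \<omega>)))\<^sup>2)"
  proof (rule Bochner_Integration.integrable_bound[OF g])
    show "AE \<omega> in M. norm ((norm (f (Y \<omega>) - f (Z \<omega>)))\<^sup>2) \<le> norm (?g \<omega>)"
      using le order_trans[OF le abs_ge_self] by simp
  qed measurable
  then have "expectation (\<lambda>\<omega>. (norm (f (Y \<omega>) - f (Z \<omega>)))\<^sup>2) \<le> expectation ?g"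
    using g le by (intro integral_mono) auto
  also have "\<dots> = 2 * A\<^sup>2 * expectation (\<lambda>\<omega>. (norm (Y \<omega> - Z \<omega>))\<^sup>2) + 2 * B\<^sup>2
      + 4 * K\<^sup>2 * ((expectation (\<lambda>\<omega>. (norm (Y \<omega>))\<^sup>2) + expectation (\<lambda>\<omega>. (norm (Z \<omega>))\<^sup>2)) / N\<^sup>2)"
    using int by (simp add: prob_space)
  also have "\<dots> \<le> 2 * A\<^sup>2 * V + 2 * B\<^sup>2 + 4 * K\<^sup>2 * ((U + U) / N\<^sup>2)"
    using U V by (intro add_mono mult_left_mono divide_right_mono) auto
  finally show ?thesis by simp
qed

theorem theorem2p3:
  fixes M :: "'a measure" and F :: "real \<Rightarrow> 'a measure"
    and W :: "real \<Rightarrow> 'a \<Rightarrow> real^'m"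
    and \<sigma> :: "real^'d \<Rightarrow> real^'m^'d" and b :: "real^'d \<Rightarrow> real^'d"
    and C \<mu> T :: real
    and xs :: "nat \<Rightarrow> real^'d" and x :: "real^'d"
    and Xs :: "nat \<Rightarrow> real \<Rightarrow> 'a \<Rightarrow> real^'d" and X :: "real \<Rightarrow> 'a \<Rightarrow> real^'d"
  assumes "filtered_prob_space M F"
    and "brownian_motion M F W"
    and "bounded (range \<sigma>)" and "continuous_on UNIV \<sigma>"
    and "bounded (range b)" and "continuous_on UNIV b"
    and "C > 0" and "\<mu> > 0"
    and "\<And>(N::nat) y z. real N > exp 1 \<Longrightarrow> norm y \<le> real N \<Longrightarrow> norm z \<le> real N \<Longrightarrow>
           norm (\<sigma> y - \<sigma> z) \<le> C * sqrt (ln (real N)) * norm (y - z)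
                                 + C * ln (real N) / real N powr \<mu>"
    and "\<And>(N::nat) y z. real N > exp 1 \<Longrightarrow> norm y \<le> real N \<Longrightarrow> norm z \<le> real N \<Longrightarrow>
           norm (b y - b z) \<le> C * ln (real N) * norm (y - z)
                             + C * ln (real N) / real N powr \<mu>"
    and "xs \<longlonglongrightarrow> x"
    and "\<And>l. sde_solution M F W b \<sigma> (xs l) (Xs l)"
    and "sde_solution M F W b \<sigma> x X"
    and "T \<ge> 0"
  shows "(\<lambda>l. \<integral>\<^sup>+\<omega>. ennreal (SUP t\<in>{0..T}. (norm (Xs l t \<omega> - X t \<omega>))\<^sup>2) \<partial>M) \<longlonglongrightarrow> 0"
proof -
  interpret brownian_filtration M F W
    using assms(1,2) by unfold_locales
  obtain K where K: "\<And>y. norm (\<sigma> y) \<le> K" "\<And>y. norm (b y) \<le> K"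
  proof -
    obtain K1 K2 where "\<forall>y. norm (\<sigma> y) \<le> K1" "\<forall>y. norm (b y) \<le> K2"
      using assms(3,5) unfolding bounded_iff by auto
    then have "norm (\<sigma> y) \<le> max K1 K2" "norm (b y) \<le> max K1 K2" for y
      by (auto intro: max.coboundedI1 max.coboundedI2)
    then show ?thesis by (rule that)
  qed
  interpret bounded_sde M F W \<sigma> b K
    using assms(4,6) K by unfold_locales
  \<comment> \<open>The rational times are defined by division by the horizon; enlarging it makes it
    positive also when \<open>T = 0\<close>.\<close>
  define T' where "T' = T + 1"
  have T': "0 < T'" "T \<le> T'" using assms(14) by (auto simp: T'_def)
  define D where "D = (\<lambda>l t \<omega>. Xs l t \<omega> - X t \<omega>)"
  have solution: "sde_solution M F W b \<sigma> (xs l) (Xs l)" "sde_solution M F W b \<sigma> x X" for l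
    by fact+
  interpret X: ito_process M F W "\<lambda>t \<omega>. b (X t \<omega>)" "\<lambda>t \<omega>. \<sigma> (X t \<omega>)" x X K
    by (rule solution_ito_process) fact
  interpret Xs: ito_process M F W "\<lambda>t \<omega>. b (Xs l t \<omega>)" "\<lambda>t \<omega>. \<sigma> (Xs l t \<omega>)" "xs l" "Xs l" K for l
    by (rule solution_ito_process) fact
  interpret D: ito_process M F W "\<lambda>t \<omega>. b (Xs l t \<omega>) - b (X t \<omega>)" "\<lambda>t \<omega>. \<sigma> (Xs l t \<omega>) - \<sigma> (X t \<omega>)"
      "xs l - x" "D l" "2 * K" for l
    unfolding D_def by (rule solution_difference_ito_process[OF solution])

  \<comment> \<open>Convergent starting points are bounded, which makes the moment bound
    \<open>U\<close> below uniform in \<open>l\<close>.\<close>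
  obtain R where R: "\<And>l. norm (xs l) \<le> R"
    using convergent_imp_bounded[OF assms(11)] unfolding bounded_iff by auto
  have xR: "norm x \<le> R"
    using tendsto_norm[OF assms(11)] R by (intro LIMSEQ_le_const2[of "\<lambda>l. norm (xs l)"]) auto
  define m where "m = real CARD('m)"
  have m: "1 \<le> m" unfolding m_def by (simp add: Suc_leI)
  define U where "U = 2 * R\<^sup>2 + 2 * (2 * T'\<^sup>2 * K\<^sup>2 + 8 * m * T' * K\<^sup>2)"
  have U: "(\<integral>\<omega>. (norm (X t \<omega>))\<^sup>2 \<partial>M) \<le> U" "(\<integral>\<omega>. (norm (Xs l t \<omega>))\<^sup>2 \<partial>M) \<le> U" if "t \<in> rat_times T'" for t l
  proof -
    have "(norm x)\<^sup>2 \<le> R\<^sup>2" "(norm (xs l))\<^sup>2 \<le> R\<^sup>2" using R xR by (auto intro!: power_mono)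
    then show "(\<integral>\<omega>. (norm (X t \<omega>))\<^sup>2 \<partial>M) \<le> U" "(\<integral>\<omega>. (norm (Xs l t \<omega>))\<^sup>2 \<partial>M) \<le> U"
      using X.sq_moment(2)[OF T'(1) that] Xs.sq_moment(2)[OF T'(1) that, of l] unfolding U_def m_def by linarith+
  qed
  have U_nonneg: "0 \<le> U" unfolding U_def using m T' by (intro add_nonneg_nonneg mult_nonneg_nonneg) auto

  define u where "u = (\<lambda>l t. \<integral>\<omega>. (norm (D l t \<omega>))\<^sup>2 \<partial>M)"
  \<comment> \<open>The exponent 2 comes from Chebyshev's \<open>1 / N\<^sup>2\<close>, and
    \<open>2 * \<mu>\<close> from squaring the additive error in the hypotheses; the slower decay
    counts.\<close>
  define p where "p = min 2 (2 * \<mu>)"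
  \<comment> \<open>The sum of the constant of the squared modulus and that of the Chebyshev term,
    so that \<open>c0\<close> dominates each of them.\<close>
  define c0 where "c0 = 2 * C\<^sup>2 + 8 * K\<^sup>2 * U"
  define e where "e = (\<lambda>N::nat. ln (real N) * real N powr - p)"
  have p: "0 < p" using assms(8) by (simp add: p_def)
  have c0: "0 < c0" using assms(7) U_nonneg by (simp add: c0_def add_pos_nonneg)

  have coeff: "(\<integral>\<omega>. (norm (b (Xs l r \<omega>) - b (X r \<omega>)))\<^sup>2 \<partial>M) \<le> c0 * (ln (real N))\<^sup>2 * (V + e N)"
    "(\<integral>\<omega>. (norm (\<sigma> (Xs l r \<omega>) - \<sigma> (X r \<omega>)))\<^sup>2 \<partial>M) \<le> c0 * ln (real N) * (V + e N)"
    if N: "real N > exp 1" and r: "r \<in> rat_times T'" and V: "u l r \<le> V" for N l r V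
  proof -
    define L where "L = ln (real N)"
    have "1 < real N" using N exp_ge_add_one_self[of 1] by linarith
    then have N0: "0 < real N" "1 < real N" by auto
    then have L: "1 \<le> L" unfolding L_def using N by (simp add: ln_ge_iff)
    have r0: "0 \<le> r" using r by (simp add: rat_times_def)
    define q where "q = real N powr - p"
    have q: "0 \<le> q" by (simp add: q_def)
    have V0: "0 \<le> V" using V unfolding u_def by (rule order_trans[rotated]) simp
    have eN: "e N = L * q" by (simp add: e_def L_def q_def)
    have "real N powr (2 * \<mu>) = (real N powr \<mu>)\<^sup>2" by (simp add: power2_eq_square flip: powr_add)
    then have "(C * L / real N powr \<mu>)\<^sup>2 = C\<^sup>2 * L\<^sup>2 * real N powr - (2 * \<mu>)"
      by (simp add: power_divide power_mult_distrib powr_minus divide_inverse power_inverse)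
    also have "\<dots> \<le> C\<^sup>2 * L\<^sup>2 * q"
      unfolding q_def p_def using N0 by (intro mult_left_mono powr_mono) auto
    finally have B: "(C * L / real N powr \<mu>)\<^sup>2 \<le> C\<^sup>2 * L\<^sup>2 * q" .
    have "1 / (real N)\<^sup>2 = real N powr - 2" using N0 by (simp add: powr_minus divide_inverse)
    also have "\<dots> \<le> q" unfolding q_def p_def using N0 by (intro powr_mono) auto
    finally have "8 * K\<^sup>2 * U * (1 / (real N)\<^sup>2) \<le> 8 * K\<^sup>2 * U * q"
      using U_nonneg by (intro mult_left_mono) auto
    also have "\<dots> \<le> 8 * K\<^sup>2 * U * (L\<^sup>2 * q)"
    proof -
      have "1 * q \<le> L\<^sup>2 * q" using L q by (intro mult_right_mono) auto
      then show ?thesis using U_nonneg by (intro mult_left_mono) auto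
    qed
    finally have tail: "8 * K\<^sup>2 * U / (real N)\<^sup>2 \<le> 8 * K\<^sup>2 * U * (L\<^sup>2 * q)" by simp
    note est = local_modulus_expectation[where Y = "Xs l r" and Z = "X r" and U = U and V = V and N = "real N" and K = K,
        OF _ _ N0(1) _ Xs.measurable_at_time(4)[OF r0] X.measurable_at_time(4)[OF r0] Xs.sq_moment(1)[OF T'(1) r]
        X.sq_moment(1)[OF T'(1) r] D.sq_moment(1)[OF T'(1) r, unfolded D_def] U(2)[OF r] U(1)[OF r]
        V[unfolded u_def D_def]]
    have rest: "2 * (C * L / real N powr \<mu>)\<^sup>2 + 8 * K\<^sup>2 * U / (real N)\<^sup>2 \<le> c0 * (L\<^sup>2 * q)"
      using B tail by (simp add: c0_def algebra_simps)
    have "L\<^sup>2 * q \<le> L\<^sup>2 * e N" unfolding eN using L q by (intro mult_left_mono) (auto simp: mult_le_cancel_right1)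
    then have q_le: "c0 * (L\<^sup>2 * q) \<le> c0 * (L\<^sup>2 * e N)"
      by (rule mult_left_mono) (use c0 in simp)
    have c0C: "2 * C\<^sup>2 \<le> c0" using U_nonneg by (simp add: c0_def)
    have "(\<integral>\<omega>. (norm (b (Xs l r \<omega>) - b (X r \<omega>)))\<^sup>2 \<partial>M)
        \<le> 2 * (C * L)\<^sup>2 * V + 2 * (C * L / real N powr \<mu>)\<^sup>2 + 8 * K\<^sup>2 * U / (real N)\<^sup>2"
      unfolding L_def by (rule est[OF assms(6) K(2) assms(10)[OF N]])
    moreover have "2 * (C * L)\<^sup>2 * V \<le> c0 * (L\<^sup>2 * V)"
      using mult_right_mono[OF c0C, of "L\<^sup>2 * V"] V0 by (simp add: power_mult_distrib ac_simps)
    ultimately have "(\<integral>\<omega>. (norm (b (Xs l r \<omega>) - b (X r \<omega>)))\<^sup>2 \<partial>M) \<le> c0 * (L\<^sup>2 * V) + c0 * (L\<^sup>2 * e N)"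
      using rest q_le by linarith
    then show "(\<integral>\<omega>. (norm (b (Xs l r \<omega>) - b (X r \<omega>)))\<^sup>2 \<partial>M) \<le> c0 * (ln (real N))\<^sup>2 * (V + e N)"
      by (simp add: L_def algebra_simps)
    have "(\<integral>\<omega>. (norm (\<sigma> (Xs l r \<omega>) - \<sigma> (X r \<omega>)))\<^sup>2 \<partial>M)
        \<le> 2 * (C * sqrt L)\<^sup>2 * V + 2 * (C * L / real N powr \<mu>)\<^sup>2 + 8 * K\<^sup>2 * U / (real N)\<^sup>2"
      unfolding L_def by (rule est[OF assms(4) K(1) assms(9)[OF N]])
    moreover have "2 * (C * sqrt L)\<^sup>2 * V \<le> c0 * (L * V)"
      using mult_right_mono[OF c0C, of "L * V"] V0 L by (simp add: power_mult_distrib ac_simps)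
    \<comment> \<open>The diffusion estimate leaves one factor \<open>L\<close> in front, whereas
      the squared additive error carries \<open>L\<^sup>2\<close>. This is why \<open>e\<close>
      contains one logarithm.\<close>
    moreover have "c0 * (L\<^sup>2 * q) = c0 * (L * e N)" by (simp add: eN power2_eq_square)
    ultimately have "(\<integral>\<omega>. (norm (\<sigma> (Xs l r \<omega>) - \<sigma> (X r \<omega>)))\<^sup>2 \<partial>M) \<le> c0 * (L * V) + c0 * (L * e N)"
      using rest by linarith
    then show "(\<integral>\<omega>. (norm (\<sigma> (Xs l r \<omega>) - \<sigma> (X r \<omega>)))\<^sup>2 \<partial>M) \<le> c0 * ln (real N) * (V + e N)"
      by (simp add: L_def algebra_simps)
  qed

  have e_nonneg: "0 \<le> e N" and ln1: "1 \<le> ln (real N)" if N: "real N > exp 1" for N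
  proof -
    have "0 < real N" using N exp_gt_zero[of 1] by linarith
    then show "1 \<le> ln (real N)" using N by (simp add: ln_ge_iff)
    then show "0 \<le> e N" by (simp add: e_def)
  qed
  have uniform: "\<forall>\<^sub>F l in sequentially. \<forall>t\<in>rat_times T'. u l t \<le> \<eta>" if \<eta>: "0 < \<eta>" for \<eta>
  proof (rule logarithmic_gronwall[OF T'(1) p])
    \<comment> \<open>The step estimate produces \<open>4 * c0\<close> for the drift and
      \<open>16 * m * c0\<close> for the noise; since \<open>1 \<le> m\<close> the latter serves for
      both.\<close>
    show "0 < 16 * m * c0" using m c0 by simp
    show "0 \<le> u l t" for l t by (simp add: u_def)
    show "u l t \<le> 2 * (R + R)\<^sup>2 + 2 * (2 * T'\<^sup>2 * (2 * K)\<^sup>2 + 8 * m * T' * (2 * K)\<^sup>2)" if "t \<in> rat_times T'" for l t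
    proof -
      have "norm (xs l - x) \<le> R + R" using norm_triangle_ineq4[of "xs l" x] R[of l] xR by linarith
      then have "(norm (xs l - x))\<^sup>2 \<le> (R + R)\<^sup>2" by (intro power_mono) auto
      then show ?thesis using D.sq_moment(2)[OF T'(1) that, of l] unfolding u_def m_def by linarith
    qed
    show "u l t \<le> 2 * u l s + 16 * m * c0 * (((t - s) * ln (real N))\<^sup>2 + (t - s) * ln (real N))
        * (V + ln (real N) * real N powr - p)"
      if N: "real N > exp 1" and st: "s \<in> rat_times T'" "t \<in> rat_times T'" "s \<le> t"
        and V: "\<And>r. r \<in> rat_times T' \<Longrightarrow> s \<le> r \<Longrightarrow> r \<le> t \<Longrightarrow> u l r \<le> V" for l N s t V
    proof -
      define L where "L = ln (real N)"
      define A where "A = V + e N"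
      have "0 \<le> u l s" by (simp add: u_def)
      then have A: "0 \<le> A" using V[OF st(1) order_refl st(3)] e_nonneg[OF N] by (simp add: A_def)
      have "u l t \<le> 2 * u l s + 2 * (2 * (t - s)\<^sup>2 * (c0 * L\<^sup>2 * A) + 8 * m * (t - s) * (c0 * L * A))"
        unfolding u_def m_def L_def A_def using V
        by (intro D.sq_moment_step[OF T'(1) st] coeff[OF N]) auto
      \<comment> \<open>Here the two moduli fit together: the squared length from Cauchy-Schwarz in
        time meets \<open>L\<^sup>2\<close> from the drift, and the single length from the
        martingale estimate meets \<open>L\<close> from the diffusion. Both terms thus depend on
        \<open>(t - s) * L\<close> alone.\<close>
      also have "\<dots> = 2 * u l s + 4 * c0 * A * ((t - s) * L)\<^sup>2 + 16 * m * c0 * A * ((t - s) * L)"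
        by (simp add: power_mult_distrib distrib_left ac_simps)
      also have "\<dots> \<le> 2 * u l s + 16 * m * c0 * A * ((t - s) * L)\<^sup>2 + 16 * m * c0 * A * ((t - s) * L)"
        using m c0 A by (intro add_mono order_refl mult_right_mono) auto
      also have "\<dots> = 2 * u l s + 16 * m * c0 * (((t - s) * L)\<^sup>2 + (t - s) * L) * A"
        by (simp add: algebra_simps)
      finally show ?thesis by (simp add: A_def L_def e_def)
    qed
    show "(\<lambda>l. u l 0) \<longlonglongrightarrow> 0"
    proof -
      have "u l 0 = (norm (xs l - x))\<^sup>2" for l
      proof -
        have "u l 0 = (\<integral>\<omega>. (norm (xs l - x))\<^sup>2 \<partial>M)"
          unfolding u_def
        proof (rule integral_cong_AE)
          show "AE \<omega> in M. (norm (D l 0 \<omega>))\<^sup>2 = (norm (xs l - x))\<^sup>2"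
            using D.Y_0[of l] by eventually_elim simp
          have [measurable]: "D l 0 \<in> borel_measurable M" by (rule D.measurable_at_time(4)) simp
          show "(\<lambda>\<omega>. (norm (D l 0 \<omega>))\<^sup>2) \<in> borel_measurable M" by measurable
        qed simp
        then show ?thesis by (simp add: prob_space)
      qed
      moreover have "(\<lambda>l. (norm (xs l - x))\<^sup>2) \<longlonglongrightarrow> (norm (x - x))\<^sup>2"
        by (intro tendsto_intros assms(11))
      ultimately show ?thesis by simp
    qed
  qed (rule \<eta>)

  define G where "G = 2 * (2 * T'\<^sup>2 * c0 + 8 * m * T' * c0)"
  have G: "0 < G" unfolding G_def using T' m c0 by (intro mult_pos_pos add_pos_pos) auto
  \<comment> \<open>\<open>N\<close> is a free parameter. The logarithmic factor is fixed once
    \<open>N\<close> is, so the uniform convergence of \<open>u\<close> suffices to control the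
    supremum.\<close>
  have sup_bound: "(\<integral>\<^sup>+\<omega>. ennreal (SUP t\<in>{0..T}. (norm (Xs l t \<omega> - X t \<omega>))\<^sup>2) \<partial>M)
      \<le> ennreal (2 * (norm (xs l - x))\<^sup>2 + G * (ln (real N))\<^sup>2 * (\<eta> + e N))"
    if N: "real N > exp 1" and \<eta>: "\<And>t. t \<in> rat_times T' \<Longrightarrow> u l t \<le> \<eta>" for l N \<eta>
  proof -
    define L where "L = ln (real N)"
    have L: "1 \<le> L" using ln1[OF N] by (simp add: L_def)
    have "0 \<le> u l 0" by (simp add: u_def)
    then have A: "0 \<le> \<eta> + e N" using \<eta>[OF rat_times_zero[OF T'(1)]] e_nonneg[OF N] by linarith
    have cont: "continuous_on {0..} (\<lambda>t. D l t \<omega>)" if "\<omega> \<in> space M" for \<omega>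
      unfolding D_def using solution that by (intro continuous_on_diff) (auto simp: sde_solution_def)
    have "(\<integral>\<^sup>+\<omega>. ennreal (SUP t\<in>{0..T}. (norm (D l t \<omega>))\<^sup>2) \<partial>M)
        \<le> (\<integral>\<^sup>+\<omega>. ennreal (SUP t\<in>{0..T'}. (norm (D l t \<omega>))\<^sup>2) \<partial>M)"
    proof (intro nn_integral_mono ennreal_leI cSUP_subset_mono)
      fix \<omega> assume \<omega>: "\<omega> \<in> space M"
      have "compact ((\<lambda>t. (norm (D l t \<omega>))\<^sup>2) ` {0..T'})"
        by (intro compact_continuous_image continuous_intros continuous_on_subset[OF cont[OF \<omega>]]) auto
      then show "bdd_above ((\<lambda>t. (norm (D l t \<omega>))\<^sup>2) ` {0..T'})"
        by (intro bounded_imp_bdd_above compact_imp_bounded)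
    qed (use assms(14) T' in auto)
    also have "\<dots> \<le> ennreal (2 * (norm (xs l - x))\<^sup>2
        + 2 * (2 * T'\<^sup>2 * (c0 * L\<^sup>2 * (\<eta> + e N)) + 8 * m * T' * (c0 * L * (\<eta> + e N))))"
      unfolding L_def m_def using \<eta> by (intro D.sup_sq_bound T'(1) cont coeff N) auto
    also have "\<dots> \<le> ennreal (2 * (norm (xs l - x))\<^sup>2 + G * L\<^sup>2 * (\<eta> + e N))"
    proof (rule ennreal_leI)
      have "8 * m * T' * c0 * (\<eta> + e N) * L \<le> 8 * m * T' * c0 * (\<eta> + e N) * L\<^sup>2"
        using m T' c0 A L by (intro mult_left_mono) (auto simp: power2_eq_square)
      then show "2 * (norm (xs l - x))\<^sup>2
        + 2 * (2 * T'\<^sup>2 * (c0 * L\<^sup>2 * (\<eta> + e N)) + 8 * m * T' * (c0 * L * (\<eta> + e N)))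
        \<le> 2 * (norm (xs l - x))\<^sup>2 + G * L\<^sup>2 * (\<eta> + e N)"
        by (simp add: G_def algebra_simps)
    qed
    finally show ?thesis by (simp add: D_def L_def)
  qed
  show ?thesis
  proof (rule order_tendstoI)
    fix a :: ennreal assume "0 < a"
    \<comment> \<open>The bound \<open>a\<close> may be infinite; a smaller \<open>a'\<close> is
      finite and comes from a real \<open>d\<close>.\<close>
    then obtain a' where a': "0 < a'" "a' < a" using dense by blast
    then obtain d where d: "a' = ennreal d" "0 < d"
      by (cases a') (auto simp: ennreal_less_zero_iff)
    \<comment> \<open>Again \<open>N\<close> precedes \<open>l\<close>. The starting points
      contribute at most \<open>2 * (d / 8)\<close>, the second moments \<open>d / 4\<close> and the
      error \<open>d / 4\<close>, so the total stays below \<open>d\<close>.\<close>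
    have "(\<lambda>N. G * (ln (real N))\<^sup>2 * (ln (real N) * real N powr - p)) \<longlonglongrightarrow> 0"
      using p by real_asymp
    then have "\<forall>\<^sub>F N in sequentially. G * (ln (real N))\<^sup>2 * e N < d / 4"
      unfolding e_def using d by (intro order_tendstoD(2)) auto
    moreover have "\<forall>\<^sub>F N in sequentially. real N > exp 1" by real_asymp
    ultimately have "\<forall>\<^sub>F N in sequentially. G * (ln (real N))\<^sup>2 * e N < d / 4 \<and> real N > exp 1"
      by (rule eventually_conj)
    then obtain N where N: "G * (ln (real N))\<^sup>2 * e N < d / 4" "real N > exp 1"
      by (auto simp: eventually_sequentially)
    define k where "k = G * (ln (real N))\<^sup>2"
    have k: "0 < k" unfolding k_def using G ln1[OF N(2)] by simp
    have "(\<lambda>l. (norm (xs l - x))\<^sup>2) \<longlonglongrightarrow> (norm (x - x))\<^sup>2"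
      by (intro tendsto_intros assms(11))
    then have "\<forall>\<^sub>F l in sequentially. (norm (xs l - x))\<^sup>2 < d / 8"
      by (rule order_tendstoD(2)) (use d in simp)
    moreover have "\<forall>\<^sub>F l in sequentially. \<forall>t\<in>rat_times T'. u l t \<le> d / (4 * k)"
      using d k by (intro uniform) auto
    ultimately show "\<forall>\<^sub>F l in sequentially. (\<integral>\<^sup>+\<omega>. ennreal (SUP t\<in>{0..T}. (norm (Xs l t \<omega> - X t \<omega>))\<^sup>2) \<partial>M) < a"
    proof eventually_elim
      case (elim l)
      have "(\<integral>\<^sup>+\<omega>. ennreal (SUP t\<in>{0..T}. (norm (Xs l t \<omega> - X t \<omega>))\<^sup>2) \<partial>M)
          \<le> ennreal (2 * (norm (xs l - x))\<^sup>2 + k * (d / (4 * k) + e N))"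
        unfolding k_def using elim by (intro sup_bound N) (auto simp: k_def)
      also have "\<dots> \<le> ennreal d"
      proof (rule ennreal_leI)
        have "k * (d / (4 * k) + e N) = d / 4 + k * e N" using k by (simp add: field_simps)
        then show "2 * (norm (xs l - x))\<^sup>2 + k * (d / (4 * k) + e N) \<le> d"
          using elim(1) N(1) d(2) by (simp add: k_def)
      qed
      also have "\<dots> < a" using a' d by simp
      finally show ?case .
    qed
  qed simp
qed

end
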